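(* Let $\eta^2=-3$, $\zeta=\frac{-1+\eta}{2}$, and let $X_\eta=\{a^4+a^2e_2(u_1,\dots,u_5)+e_4(u_1,\dots,u_5)=0\}$ in the hyperplane $L_\eta:\ u_1+\cdots+u_5=\eta a$ of $\mathbb{P}^5$, a model of the Burkhardt quartic. The forty planes $$\{\Pi_{ij}: i\neq j,\ 1\le i,j\le 5\}\quad\text{and}\quad\{\Lambda_{pq}^{rst},\ \Lambda_{pq}^{rts}: 1\le p<q\le 5\}$$ in $L_\eta$, where $\Pi_{ij}:\ a+u_i=0,\ a-u_j=0$ and, with $\{r,s,t\}=\{1,\dots,5\}\setminus\{p,q\}$, $$\Lambda_{pq}^{rst}:\ u_p+u_q=0,\quad u_r+\zeta u_s+\zeta^2u_t=0,\qquad \Lambda_{pq}^{rts}:\ u_p+u_q=0,\quad u_r+\zeta^2u_s+\zeta u_t=0,$$ are precisely the forty Jacobi planes on the Burkhardt quartic $X_\eta$.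
   Context: We work over $\mathbb{C}$; $e_r$ is the elementary symmetric polynomial of degree $r$, and $a,u_1,\dots,u_5$ are homogeneous coordinates on $\mathbb{P}^5$. The Burkhardt quartic is the quartic threefold $\{\sigma_1(x_0,\dots,x_5)=\sigma_4(x_0,\dots,x_5)=0\}\subset\mathbb{P}^5$ ($\sigma_r$ elementary symmetric polynomials in six variables), up to projective equivalence; it has exactly $45$ singular points, all nodes, and $X_\eta$ is projectively equivalent to it. A Jacobi plane of the Burkhardt quartic is a plane contained in the quartic and containing exactly nine of its $45$ nodes (classically, the planes containing nine nodes are precisely the Jacobi planes, they are contained in the quartic, and there are exactly forty of them). The forty-five nodes of $X_\eta$ are the following points $[a:u_1:\dots:u_5]$ of $L_\eta$. (i) For a partition $\{1,\dots,5\}=A\sqcup B\sqcup\{c\}$ with $|A|=|B|=2$, $R_{A,B;c}$ has $a=1$, $u_i=-1$ for $i\in A$, $u_j=1$ for $j\in B$, $u_c=\eta$. (ii) For $C=\{p,q\}\subset\{1,\dots,5\}$ with $p\ne q$, $T_C$ has $a=0$, $u_i=0$ for $i\notin C$, $u_p=1$, $u_q=-1$. (iii) For $c\in\{1,\dots,5\}$, $E_c$ has $a=1$, $u_c=-\eta/3$, $u_i=\eta/3$ for $i\neq c$. For fixed $\{p,q\}$, the plane $\Lambda_{pq}^{rst}$ depends only on the cyclic order of $(r,s,t)$, and reversing the cyclic order interchanges $\Lambda_{pq}^{rst}$ and $\Lambda_{pq}^{rts}$. *)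

theory Defs
  imports "HOL-Analysis.Analysis"
begin

text \<open>
  Points and linear subspaces of \<open>\<P>\<^sup>5\<close> are handled as complex linear subspaces of
  \<open>\<complex>\<^sup>6\<close> (with respect to \<open>*s\<close>, not the real vector space structure): points have
  dimension 1, planes dimension 3, and subvarieties are given by their affine cones.
  The index type \<open>6\<close> has the elements \<open>0 < 1 < \<dots> < 5\<close>; the homogeneous coordinates
  \<open>[a : u\<^sub>1 : \<dots> : u\<^sub>5]\<close> of \<open>x\<close> are \<open>a = x $ 0\<close> and \<open>u\<^sub>i = x $ i\<close> for \<open>i \<in> {1..5}\<close>.
\<close>

definition elem_sym :: "nat \<Rightarrow> complex ^ 6 \<Rightarrow> complex" where
  "elem_sym r x = (\<Sum>S | S \<subseteq> {1..5} \<and> card S = r. \<Prod>i\<in>S. x $ i)"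

definition quartic_form :: "complex ^ 6 \<Rightarrow> complex" where
  "quartic_form x = (x $ 0) ^ 4 + (x $ 0) ^ 2 * elem_sym 2 x + elem_sym 4 x"

definition L_hyp :: "complex \<Rightarrow> (complex ^ 6) set" where
  "L_hyp \<eta> = {x. (\<Sum>i\<in>{1..5}. x $ i) = \<eta> * x $ 0}"

definition X_quartic :: "complex \<Rightarrow> (complex ^ 6) set" where
  "X_quartic \<eta> = {x \<in> L_hyp \<eta>. quartic_form x = 0}"

definition dir_deriv ::
    "(complex ^ 6 \<Rightarrow> complex) \<Rightarrow> complex ^ 6 \<Rightarrow> complex ^ 6 \<Rightarrow> complex" where
  "dir_deriv F v x = deriv (\<lambda>t. F (x + t *s v)) 0"

text \<open>
  Singular points and nodes (ordinary double points) of the hypersurface \<open>F = 0\<close> in the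
  projective space of lines in a linear subspace \<open>L\<close>, for a homogeneous polynomial \<open>F\<close>.
  At a singular point \<open>x\<close> Euler's identity puts \<open>x\<close> itself into the radical of the Hessian
  form on \<open>L\<close>, and the induced form on \<open>L / \<langle>x\<rangle>\<close> is the Hessian of a local equation in
  an affine chart (up to a nonzero scalar); a node is a singular point where the latter is
  nondegenerate.
\<close>

definition singular_at ::
    "(complex ^ 6 \<Rightarrow> complex) \<Rightarrow> (complex ^ 6) set \<Rightarrow> complex ^ 6 \<Rightarrow> bool" where
  "singular_at F L x \<longleftrightarrow>
     x \<in> L \<and> x \<noteq> 0 \<and> F x = 0 \<and> (\<forall>v\<in>L. dir_deriv F v x = 0)"

definition node_at ::
    "(complex ^ 6 \<Rightarrow> complex) \<Rightarrow> (complex ^ 6) set \<Rightarrow> complex ^ 6 \<Rightarrow> bool" where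
  "node_at F L x \<longleftrightarrow> singular_at F L x \<and>
     (\<forall>v\<in>L. (\<forall>w\<in>L. dir_deriv (dir_deriv F w) v x = 0) \<longrightarrow> v \<in> vec.span {x})"

definition X_nodes :: "complex \<Rightarrow> (complex ^ 6) set set" where
  "X_nodes \<eta> = {vec.span {x} | x. node_at quartic_form (L_hyp \<eta>) x}"

definition proj_plane :: "(complex ^ 6) set \<Rightarrow> bool" where
  "proj_plane P \<longleftrightarrow> vec.subspace P \<and> vec.dim P = 3"

definition jacobi_plane :: "complex \<Rightarrow> (complex ^ 6) set \<Rightarrow> bool" where
  "jacobi_plane \<eta> P \<longleftrightarrow>
     proj_plane P \<and> P \<subseteq> X_quartic \<eta> \<and> card {N \<in> X_nodes \<eta>. N \<subseteq> P} = 9"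

definition Pi_plane :: "complex \<Rightarrow> 6 \<Rightarrow> 6 \<Rightarrow> (complex ^ 6) set" where
  "Pi_plane \<eta> i j = {x \<in> L_hyp \<eta>. x $ 0 + x $ i = 0 \<and> x $ 0 - x $ j = 0}"

text \<open>
  \<open>Lambda_plane \<eta> \<zeta> p q r s t\<close> is \<open>\<Lambda>\<^bsub>pq\<^esub>\<^bsup>rst\<^esup>\<close>; the second plane
  \<open>\<Lambda>\<^bsub>pq\<^esub>\<^bsup>rts\<^esup>\<close> is obtained by exchanging the arguments \<open>s\<close> and \<open>t\<close>.
\<close>

definition Lambda_plane ::
    "complex \<Rightarrow> complex \<Rightarrow> 6 \<Rightarrow> 6 \<Rightarrow> 6 \<Rightarrow> 6 \<Rightarrow> 6 \<Rightarrow> (complex ^ 6) set" where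
  "Lambda_plane \<eta> \<zeta> p q r s t =
     {x \<in> L_hyp \<eta>. x $ p + x $ q = 0 \<and> x $ r + \<zeta> * x $ s + \<zeta>\<^sup>2 * x $ t = 0}"

definition Pi_planes :: "complex \<Rightarrow> (complex ^ 6) set set" where
  "Pi_planes \<eta> = {Pi_plane \<eta> i j | i j. i \<in> {1..5} \<and> j \<in> {1..5} \<and> i \<noteq> j}"

definition Lambda_planes :: "complex \<Rightarrow> complex \<Rightarrow> (complex ^ 6) set set" where
  "Lambda_planes \<eta> \<zeta> = {Lambda_plane \<eta> \<zeta> p q r s t | p q r s t.
     p \<in> {1..5} \<and> q \<in> {1..5} \<and> p < q \<and> {r, s, t} = {1..5} - {p, q}}"

end

theory Submission
  imports Defs
begin

text \<open>
  If a plane \<open>P \<subseteq> X\<close> lies in a hyperplane \<open>a + u\<^sub>i = 0\<close>, then it lies in some \<open>a - u\<^sub>j = 0\<close>, because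
  the quartic form restricts to \<open>\<Prod>\<^bsub>k \<noteq> i\<^esub> (a - u\<^sub>k)\<close>; similarly, on \<open>u\<^sub>p + u\<^sub>q = 0\<close> the form splits, up
  to a scalar, into \<open>a + u\<^sub>p\<close>, \<open>a - u\<^sub>p\<close> and the equations of the two planes \<open>\<Lambda>\<close>. So it is enough to
  show that every plane in \<open>X\<close>, Jacobi or not, lies in a hyperplane of one of the types
  \<open>a + u\<^sub>i = 0\<close>, \<open>a - u\<^sub>i = 0\<close>, \<open>u\<^sub>p + u\<^sub>q = 0\<close>. If the first two types do not occur, the
  factorization on \<open>P \<inter> {a + u\<^sub>m = 0}\<close> gives for each \<open>m\<close> some \<open>f m \<noteq> m\<close> with \<open>a - u\<^bsub>f m\<^esub>\<close> proportional to
  \<open>a + u\<^sub>m\<close> on \<open>P\<close>. Modulo \<open>a\<close>, the coordinates \<open>u\<^sub>m\<close> and \<open>u\<^bsub>f m\<^esub>\<close> are proportional, while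
  \<open>f (f m) = m\<close> forces \<open>u\<^sub>m + u\<^bsub>f m\<^esub> = 0\<close>. As \<open>P\<close> has dimension 3, at least two coordinates are
  independent modulo \<open>a\<close>, and their \<open>f\<close>-orbits would be disjoint with at least three elements each. (If \<open>a\<close> vanishes on \<open>P\<close>,
  three independent coordinates \<open>u\<^sub>m\<close> have disjoint orbits with at least two elements each.)

  Conversely, along each of the forty planes \<open>l = m = 0\<close> the differential of the form is
  \<open>C \<cdot> dl + D \<cdot> dm\<close> with explicit cubics \<open>C\<close> and \<open>D\<close> on the plane; the nine solutions of \<open>C = D = 0\<close>
  are found directly and are nodes by a computation of the Hessian.
\<close>

subsection \<open>Coordinates\<close>

definition indices :: "6 set" where "indices = {1..5}"

text \<open>The order on the type \<open>6\<close> is the order of the representatives 0, ..., 5,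
  which turns the claim into integer inequalities.\<close>

lemma indices_eq_Compl: "indices = - {0}"
proof -
  have "1 \<le> x \<and> x \<le> 5 \<longleftrightarrow> x \<noteq> 0" for x :: 6
  proof -
    have *: "0 \<le> Rep_bit0 x" "Rep_bit0 x < 6"
      using Rep_bit0[of x] by simp_all
    have "Rep_bit0 (1::6) = 1" "Rep_bit0 (5::6) = 5" "Rep_bit0 (0::6) = 0"
      by (simp_all add: bit0.Rep_1 bit0.Rep_numeral bit0.Rep_0)
    then have "1 \<le> x \<longleftrightarrow> 1 \<le> Rep_bit0 x" "x \<le> 5 \<longleftrightarrow> Rep_bit0 x \<le> 5" "x = 0 \<longleftrightarrow> Rep_bit0 x = 0"
      unfolding less_eq_bit0_def by (metis Rep_bit0_inject)+
    with * show ?thesis by linarith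
  qed
  then show ?thesis unfolding indices_def
    by (intro set_eqI) (simp only: atLeastAtMost_iff Compl_iff singleton_iff not_False_eq_True)
qed

lemma card_indices: "card indices = 5"
  unfolding indices_eq_Compl by (subst Compl_eq_Diff_UNIV, subst card_Diff_singleton) simp_all

lemma finite_indices [simp]: "finite indices"
  unfolding indices_eq_Compl by simp

text \<open>\<open>elem_sym\<close> with index set and function left free, so that it can be
  evaluated by peeling off one index at a time.\<close>

definition esym :: "nat \<Rightarrow> ('b \<Rightarrow> 'a::comm_semiring_1) \<Rightarrow> 'b set \<Rightarrow> 'a" where
  "esym k f A = (\<Sum>S | S \<subseteq> A \<and> card S = k. \<Prod>i\<in>S. f i)"

lemma elem_sym_eq_esym: "elem_sym k x = esym k (($) x) indices"
  unfolding elem_sym_def esym_def indices_def ..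

lemma esym_0: "finite A \<Longrightarrow> esym 0 f A = 1"
proof -
  assume "finite A"
  then have "{S. S \<subseteq> A \<and> card S = 0} = {{}}"
    by (auto dest: finite_subset)
  then show ?thesis by (simp add: esym_def)
qed

lemma esym_empty: "esym (Suc k) f ({} :: 'b set) = 0"
proof -
  have "{S. S \<subseteq> ({} :: 'b set) \<and> card S = Suc k} = {}" by auto
  then show ?thesis unfolding esym_def by (simp only: sum.empty)
qed

text \<open>The subsets of size \<open>Suc k\<close> either avoid \<open>a\<close> or contain it;
  removing \<open>a\<close> matches the latter with the subsets of \<open>A\<close> of size
  \<open>k\<close>.\<close>

lemma esym_insert:
  assumes "finite A" "a \<notin> A"
  shows "esym (Suc k) f (insert a A) = esym (Suc k) f A + f a * esym k f A"
proof -
  let ?S = "\<lambda>k. {S. S \<subseteq> A \<and> card S = k}"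
  have fin: "finite (?S j)" for j using assms(1) by simp
  have inj: "inj_on (insert a) (?S k)"
    using assms(2) by (intro inj_onI) (metis (mono_tags, lifting) Diff_insert_absorb in_mono mem_Collect_eq)
  have eq: "{S. S \<subseteq> insert a A \<and> card S = Suc k} = ?S (Suc k) \<union> insert a ` ?S k"
  proof (intro set_eqI iffI)
    fix S assume S: "S \<in> {S. S \<subseteq> insert a A \<and> card S = Suc k}"
    show "S \<in> ?S (Suc k) \<union> insert a ` ?S k"
    proof (cases "a \<in> S")
      case True
      then have "S = insert a (S - {a})" "S - {a} \<in> ?S k"
        using S assms by auto
      then show ?thesis by blast
    next
      case False
      then show ?thesis using S by auto
    qed
  next
    fix S assume "S \<in> ?S (Suc k) \<union> insert a ` ?S k"
    then show "S \<in> {S. S \<subseteq> insert a A \<and> card S = Suc k}"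
      using assms by (auto simp: card_insert_if finite_subset)
  qed
  have "esym (Suc k) f (insert a A) = esym (Suc k) f A + (\<Sum>S\<in>insert a ` ?S k. \<Prod>i\<in>S. f i)"
    unfolding esym_def eq using assms(2) fin by (subst sum.union_disjoint) auto
  also have "(\<Sum>S\<in>insert a ` ?S k. \<Prod>i\<in>S. f i) = (\<Sum>S\<in>?S k. f a * (\<Prod>i\<in>S. f i))"
    unfolding sum.reindex[OF inj] o_def
  proof (rule sum.cong[OF refl])
    fix S assume "S \<in> ?S k"
    then have "finite S" "a \<notin> S" using assms finite_subset by auto
    then show "(\<Prod>i\<in>insert a S. f i) = f a * (\<Prod>i\<in>S. f i)" by simp
  qed
  finally show ?thesis by (simp add: esym_def sum_distrib_left)
qed

text \<open>
  A frame is an arbitrary numbering of the coordinates \<open>u\<^sub>1, \<dots>, u\<^sub>5\<close>; interpreting the locale with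
  permuted arguments replaces the action of the symmetric group on \<open>X\<close>.
\<close>

locale frame =
  fixes p q r s t :: 6
  assumes dist: "distinct [p, q, r, s, t]" and ix: "{p, q, r, s, t} = indices"
begin

lemma nz: "p \<noteq> 0" "q \<noteq> 0" "r \<noteq> 0" "s \<noteq> 0" "t \<noteq> 0"
  using ix unfolding indices_eq_Compl by blast+

lemmas ne = dist[simplified] nz nz[symmetric]

lemma UNIV_frame: "UNIV = {0, p, q, r, s, t}"
  using ix unfolding indices_eq_Compl by blast

lemma vec_eq_frame:
  "x = y \<longleftrightarrow> x $ 0 = y $ 0 \<and> x $ p = y $ p \<and> x $ q = y $ q \<and> x $ r = y $ r \<and> x $ s = y $ s \<and> x $ t = y $ t"
  for x y :: "'a ^ 6"
proof
  assume *: "x $ 0 = y $ 0 \<and> x $ p = y $ p \<and> x $ q = y $ q \<and> x $ r = y $ r \<and> x $ s = y $ s \<and> x $ t = y $ t"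
  show "x = y"
    unfolding vec_eq_iff
  proof
    fix i :: 6
    have "i \<in> {0, p, q, r, s, t}" unfolding UNIV_frame[symmetric] by simp
    then show "x $ i = y $ i" using * by blast
  qed
qed simp

lemma L_hyp_frame: "x \<in> L_hyp \<eta> \<longleftrightarrow> x $ p + x $ q + x $ r + x $ s + x $ t = \<eta> * x $ 0"
  unfolding L_hyp_def indices_def[symmetric] ix[symmetric] using dist by (simp add: add.assoc)

lemma quartic_frame:
  "quartic_form x = (x $ 0)^4 + (x $ 0)\<^sup>2 * (x $ p * x $ q + x $ p * x $ r + x $ p * x $ s + x $ p * x $ t + x $ q * x $ r + x $ q * x $ s + x $ q * x $ t + x $ r * x $ s + x $ r * x $ t + x $ s * x $ t) + (x $ p * x $ q * x $ r * x $ s + x $ p * x $ q * x $ r * x $ t + x $ p * x $ q * x $ s * x $ t + x $ p * x $ r * x $ s * x $ t + x $ q * x $ r * x $ s * x $ t)"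
proof -
  have "elem_sym 2 x = x $ p * x $ q + x $ p * x $ r + x $ p * x $ s + x $ p * x $ t + x $ q * x $ r + x $ q * x $ s + x $ q * x $ t + x $ r * x $ s + x $ r * x $ t + x $ s * x $ t"
    unfolding elem_sym_eq_esym ix[symmetric] numeral_2_eq_2 using dist
    by (simp add: esym_insert esym_empty esym_0 algebra_simps)
  moreover have four: "4 = Suc (Suc (Suc (Suc 0)))" by simp
  have "elem_sym 4 x = x $ p * x $ q * x $ r * x $ s + x $ p * x $ q * x $ r * x $ t + x $ p * x $ q * x $ s * x $ t + x $ p * x $ r * x $ s * x $ t + x $ q * x $ r * x $ s * x $ t"
    unfolding elem_sym_eq_esym ix[symmetric] four using dist
    by (simp add: esym_insert esym_empty esym_0 algebra_simps)
  ultimately show ?thesis unfolding quartic_form_def by simp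
qed

lemma dir_deriv_frame:
  "dir_deriv quartic_form v x =
    v $ 0 * (4 * (x $ 0)^3 + 2 * x $ 0 * (x $ p * x $ q + x $ p * x $ r + x $ p * x $ s + x $ p * x $ t + x $ q * x $ r + x $ q * x $ s + x $ q * x $ t + x $ r * x $ s + x $ r * x $ t + x $ s * x $ t))
    + v $ p * ((x $ 0)\<^sup>2 * (x $ q + x $ r + x $ s + x $ t) + (x $ q * x $ r * x $ s + x $ q * x $ r * x $ t + x $ q * x $ s * x $ t + x $ r * x $ s * x $ t))
    + v $ q * ((x $ 0)\<^sup>2 * (x $ p + x $ r + x $ s + x $ t) + (x $ p * x $ r * x $ s + x $ p * x $ r * x $ t + x $ p * x $ s * x $ t + x $ r * x $ s * x $ t))
    + v $ r * ((x $ 0)\<^sup>2 * (x $ p + x $ q + x $ s + x $ t) + (x $ p * x $ q * x $ s + x $ p * x $ q * x $ t + x $ p * x $ s * x $ t + x $ q * x $ s * x $ t))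
    + v $ s * ((x $ 0)\<^sup>2 * (x $ p + x $ q + x $ r + x $ t) + (x $ p * x $ q * x $ r + x $ p * x $ q * x $ t + x $ p * x $ r * x $ t + x $ q * x $ r * x $ t))
    + v $ t * ((x $ 0)\<^sup>2 * (x $ p + x $ q + x $ r + x $ s) + (x $ p * x $ q * x $ r + x $ p * x $ q * x $ s + x $ p * x $ r * x $ s + x $ q * x $ r * x $ s))"
  unfolding dir_deriv_def quartic_frame
  by (rule DERIV_imp_deriv, unfold vector_add_component vector_smult_component) ((rule derivative_eq_intros refl)+, simp, algebra)

text \<open>The formula of \<open>dir_deriv_frame\<close> is differentiated once more with
  \<open>w\<close> fixed. There are no terms such as \<open>v $ p * w $ p\<close>, because the form
  has degree at most one in each \<open>u_i\<close>.\<close>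

lemma hessian_frame:
  "dir_deriv (dir_deriv quartic_form w) v x =
    v $ 0 * w $ 0 * (12 * (x $ 0)\<^sup>2 + 2 * (x $ p * x $ q + x $ p * x $ r + x $ p * x $ s + x $ p * x $ t + x $ q * x $ r + x $ q * x $ s + x $ q * x $ t + x $ r * x $ s + x $ r * x $ t + x $ s * x $ t))
    + (v $ 0 * w $ p + v $ p * w $ 0) * (2 * x $ 0 * (x $ q + x $ r + x $ s + x $ t))
    + (v $ 0 * w $ q + v $ q * w $ 0) * (2 * x $ 0 * (x $ p + x $ r + x $ s + x $ t))
    + (v $ 0 * w $ r + v $ r * w $ 0) * (2 * x $ 0 * (x $ p + x $ q + x $ s + x $ t))
    + (v $ 0 * w $ s + v $ s * w $ 0) * (2 * x $ 0 * (x $ p + x $ q + x $ r + x $ t))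
    + (v $ 0 * w $ t + v $ t * w $ 0) * (2 * x $ 0 * (x $ p + x $ q + x $ r + x $ s))
    + (v $ p * w $ q + v $ q * w $ p) * ((x $ 0)\<^sup>2 + (x $ r * x $ s + x $ r * x $ t + x $ s * x $ t))
    + (v $ p * w $ r + v $ r * w $ p) * ((x $ 0)\<^sup>2 + (x $ q * x $ s + x $ q * x $ t + x $ s * x $ t))
    + (v $ p * w $ s + v $ s * w $ p) * ((x $ 0)\<^sup>2 + (x $ q * x $ r + x $ q * x $ t + x $ r * x $ t))
    + (v $ p * w $ t + v $ t * w $ p) * ((x $ 0)\<^sup>2 + (x $ q * x $ r + x $ q * x $ s + x $ r * x $ s))
    + (v $ q * w $ r + v $ r * w $ q) * ((x $ 0)\<^sup>2 + (x $ p * x $ s + x $ p * x $ t + x $ s * x $ t))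
    + (v $ q * w $ s + v $ s * w $ q) * ((x $ 0)\<^sup>2 + (x $ p * x $ r + x $ p * x $ t + x $ r * x $ t))
    + (v $ q * w $ t + v $ t * w $ q) * ((x $ 0)\<^sup>2 + (x $ p * x $ r + x $ p * x $ s + x $ r * x $ s))
    + (v $ r * w $ s + v $ s * w $ r) * ((x $ 0)\<^sup>2 + (x $ p * x $ q + x $ p * x $ t + x $ q * x $ t))
    + (v $ r * w $ t + v $ t * w $ r) * ((x $ 0)\<^sup>2 + (x $ p * x $ q + x $ p * x $ s + x $ q * x $ s))
    + (v $ s * w $ t + v $ t * w $ s) * ((x $ 0)\<^sup>2 + (x $ p * x $ q + x $ p * x $ r + x $ q * x $ r))"
  unfolding dir_deriv_def[of "dir_deriv quartic_form w"] dir_deriv_frame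
  by (rule DERIV_imp_deriv, unfold vector_add_component vector_smult_component) ((rule derivative_eq_intros refl)+, simp, algebra)

end

subsection \<open>Linear forms and subspaces\<close>

text \<open>One identity packs additivity and homogeneity for \<open>*s\<close>, in the shape needed
  to restrict a form to a line.\<close>

definition lin_form :: "('a::field ^ 'n \<Rightarrow> 'a) \<Rightarrow> bool" where
  "lin_form f \<longleftrightarrow> (\<forall>x y c. f (x + c *s y) = f x + c * f y)"

lemma lin_formD: "lin_form f \<Longrightarrow> f (x + c *s y) = f x + c * f y"
  by (simp add: lin_form_def)

text \<open>A linear subspace over an infinite field is irreducible. If no factor vanished on
  \<open>P\<close>, take \<open>y\<close> off the zeros of the head and \<open>x\<close> off the
  zeros of the tail; on the line \<open>x + c *s y\<close> every factor is then a nonzero polynomial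
  in \<open>c\<close>, and so is the product.\<close>

lemma lin_form_vanishes_if_prod_vanishes:
  fixes P :: "('a::field_char_0 ^ 'n) set"
  assumes "vec.subspace P" and "\<forall>f\<in>set fs. lin_form f"
    and "\<forall>x\<in>P. prod_list (map (\<lambda>f. f x) fs) = 0"
  shows "\<exists>f\<in>set fs. \<forall>x\<in>P. f x = 0"
  using assms(2,3)
proof (induction fs)
  case Nil
  then show ?case using vec.subspace_0[OF assms(1)] by auto
next
  case (Cons g fs)
  show ?case
  proof (rule ccontr)
    assume neg: "\<not> ?case"
    then obtain y where y: "y \<in> P" "g y \<noteq> 0" by auto
    from neg Cons obtain x where x: "x \<in> P" "prod_list (map (\<lambda>f. f x) fs) \<noteq> 0"
      by (metis list.set_intros(2))
    have lin: "poly (prod_list (map (\<lambda>f. [:f x, f y:]) hs)) c = prod_list (map (\<lambda>f. f (x + c *s y)) hs)"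
      if "set hs \<subseteq> set (g # fs)" for c hs
      using that Cons.prems(1) by (induction hs) (auto simp: lin_formD distrib_right mult.assoc)
    have "poly (prod_list (map (\<lambda>f. [:f x, f y:]) (g # fs))) c = 0" for c
    proof -
      have "x + c *s y \<in> P"
        using x y assms(1) by (simp add: vec.subspace_add vec.subspace_scale)
      then show ?thesis using Cons.prems(2) lin[of "g # fs"] by auto
    qed
    then have "prod_list (map (\<lambda>f. [:f x, f y:]) (g # fs)) = 0"
      using poly_all_0_iff_0 by blast
    then have "\<exists>f\<in>set (g # fs). [:f x, f y:] = 0"
      unfolding prod_list_zero_iff by auto
    then show False
      using x y by (auto simp: prod_list_zero_iff image_iff)
  qed
qed

text \<open>Subtracting a multiple of \<open>x\<close> moves any \<open>y\<close> into the kernel of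
  \<open>f\<close>, which yields the factor \<open>g x / f x\<close>.\<close>

lemma lin_form_multiple_if_kernel:
  assumes P: "vec.subspace P" and f: "lin_form f" and g: "lin_form g"
    and x: "x \<in> P" "f x \<noteq> 0" and ker: "\<And>y. y \<in> P \<Longrightarrow> f y = 0 \<Longrightarrow> g y = 0"
  shows "\<exists>c. \<forall>y\<in>P. g y = c * f y"
proof (intro exI ballI)
  fix y assume y: "y \<in> P"
  have "y + (- f y / f x) *s x \<in> P"
    using x y P by (intro vec.subspace_add vec.subspace_scale)
  then have "g (y + (- f y / f x) *s x) = 0"
    using ker lin_formD[OF f, of y "- f y / f x" x] x by simp
  then show "g y = g x / f x * f y"
    using lin_formD[OF g, of y "- f y / f x" x] by simp
qed

text \<open>A vector \<open>b\<close> of \<open>P\<close> off the hyperplane, if there is one, spans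
  \<open>P\<close> together with the hyperplane section.\<close>

lemma dim_inter_coordinate_hyperplane:
  fixes P :: "('a::field ^ 'n) set"
  assumes "vec.subspace P"
  shows "vec.dim P \<le> Suc (vec.dim (P \<inter> {x. x $ i = 0}))"
proof (cases "\<exists>b\<in>P. b $ i \<noteq> 0")
  case True
  then obtain b where b: "b \<in> P" "b $ i \<noteq> 0" by blast
  have "P \<subseteq> vec.span (insert b (P \<inter> {x. x $ i = 0}))"
  proof
    fix x assume "x \<in> P"
    then have "x - (x $ i / b $ i) *s b \<in> P \<inter> {x. x $ i = 0}"
      using b assms by (simp add: vec.subspace_diff vec.subspace_scale)
    then show "x \<in> vec.span (insert b (P \<inter> {x. x $ i = 0}))"
      by (metis vec.span_breakdown_eq vec.span_base)
  qed
  then have "vec.dim P \<le> vec.dim (insert b (P \<inter> {x. x $ i = 0}))"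
    by (rule vec.dim_mono)
  then show ?thesis by (simp add: vec.dim_insert split: if_splits)
next
  case False
  then have "P \<inter> {x. x $ i = 0} = P" by blast
  then show ?thesis by simp
qed

text \<open>Source of the test vectors in \<open>in_Pi_or_Lambda\<close>; with \<open>i = j\<close>
  only a single condition is imposed.\<close>

lemma ex_nonzero_two_coordinates_zero:
  fixes P :: "('a::field ^ 'n) set"
  assumes "vec.subspace P" "vec.dim P = 3"
  shows "\<exists>x\<in>P. x \<noteq> 0 \<and> x $ i = 0 \<and> x $ j = 0"
proof -
  let ?H = "\<lambda>i. {x :: 'a ^ 'n. x $ i = 0}"
  have "vec.subspace (P \<inter> ?H i)"
    using assms(1) by (auto simp: vec.subspace_def)
  from dim_inter_coordinate_hyperplane[OF this, of j]
  have "vec.dim (P \<inter> ?H i \<inter> ?H j) \<noteq> 0"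
    using dim_inter_coordinate_hyperplane[OF assms(1), of i] assms(2) by linarith
  then show ?thesis by (auto simp: vec.dim_eq_0)
qed

text \<open>The coordinates \<open>i\<close>, \<open>j\<close>, \<open>k\<close> serve as a
  coordinate system on \<open>P\<close> with dual basis \<open>b\<close>, \<open>c\<close>,
  \<open>d\<close>.\<close>

lemma dim_eq_3I:
  fixes P :: "('a::field ^ 'n) set"
  assumes "b \<in> P" "c \<in> P" "d \<in> P"
    and "b $ i = 1" "b $ j = 0" "b $ k = 0"
    and "c $ i = 0" "c $ j = 1" "c $ k = 0"
    and "d $ i = 0" "d $ j = 0" "d $ k = 1"
    and rep: "\<And>x. x \<in> P \<Longrightarrow> x = x $ i *s b + x $ j *s c + x $ k *s d"
  shows "vec.dim P = 3"
proof (rule vec.dim_unique)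
  show "{b, c, d} \<subseteq> P" using assms by simp
  show "P \<subseteq> vec.span {b, c, d}"
  proof
    fix x assume "x \<in> P"
    from rep[OF this] show "x \<in> vec.span {b, c, d}"
      by (metis insert_iff vec.span_add vec.span_base vec.span_scale)
  qed
  have coord: "x $ l = 0" if "x \<in> vec.span S" "\<And>y. y \<in> S \<Longrightarrow> y $ l = 0" for x :: "'a ^ 'n" and S l
    using that(1) by (induction rule: vec.span_induct_alt) (simp_all add: that(2))
  have "b \<notin> vec.span {c, d}" using coord[of b "{c, d}" i] assms by auto
  moreover have "c \<notin> vec.span {d}" using coord[of c "{d}" j] assms by auto
  moreover have "d \<notin> vec.span {}" using assms by auto
  moreover have "d \<noteq> 0" "c \<noteq> d" "b \<noteq> c" "b \<noteq> d" using assms by auto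
  ultimately show "vec.independent {b, c, d}"
    by (simp add: vec.independent_insert vec.independent_empty)
  show "card {b, c, d} = 3"
    using \<open>c \<noteq> d\<close> \<open>b \<noteq> c\<close> \<open>b \<noteq> d\<close> by simp
qed

subsection \<open>The forty planes and their nodes\<close>

context frame
begin

definition pt :: "complex \<Rightarrow> complex \<Rightarrow> complex \<Rightarrow> complex \<Rightarrow> complex \<Rightarrow> complex \<Rightarrow> complex ^ 6" where
  "pt a x1 x2 x3 x4 x5 = (\<chi> i. if i = 0 then a else if i = p then x1 else if i = q then x2
     else if i = r then x3 else if i = s then x4 else x5)"

lemma pt_nth [simp]:
  "pt a x1 x2 x3 x4 x5 $ 0 = a" "pt a x1 x2 x3 x4 x5 $ p = x1" "pt a x1 x2 x3 x4 x5 $ q = x2"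
  "pt a x1 x2 x3 x4 x5 $ r = x3" "pt a x1 x2 x3 x4 x5 $ s = x4" "pt a x1 x2 x3 x4 x5 $ t = x5"
  using ne by (auto simp: pt_def)

lemma pt_eq_iff [simp]:
  "pt a x1 x2 x3 x4 x5 = pt b y1 y2 y3 y4 y5 \<longleftrightarrow>
    a = b \<and> x1 = y1 \<and> x2 = y2 \<and> x3 = y3 \<and> x4 = y4 \<and> x5 = y5"
  by (simp add: vec_eq_frame)

lemma mem_Pi_plane:
  "x \<in> Pi_plane \<eta> p q \<longleftrightarrow> x $ p = - x $ 0 \<and> x $ q = x $ 0 \<and> x $ r + x $ s + x $ t = \<eta> * x $ 0"
  unfolding Pi_plane_def mem_Collect_eq L_hyp_frame by (intro iffI conjI; elim conjE; algebra)

lemma mem_Lambda_plane: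
  "x \<in> Lambda_plane \<eta> \<zeta> p q r s t \<longleftrightarrow>
    x $ q = - x $ p \<and> x $ r + x $ s + x $ t = \<eta> * x $ 0 \<and> x $ r + \<zeta> * x $ s + \<zeta>\<^sup>2 * x $ t = 0"
proof -
  have "x $ p + x $ q = 0 \<longleftrightarrow> x $ q = - x $ p"
    by (metis add.commute eq_neg_iff_add_eq_0)
  then show ?thesis
    unfolding Lambda_plane_def mem_Collect_eq L_hyp_frame by auto
qed

lemma subspace_Pi_plane: "vec.subspace (Pi_plane \<eta> p q)"
proof (rule vec.subspaceI)
  show "0 \<in> Pi_plane \<eta> p q" by (simp add: mem_Pi_plane)
next
  fix x y assume "x \<in> Pi_plane \<eta> p q" "y \<in> Pi_plane \<eta> p q"
  then show "x + y \<in> Pi_plane \<eta> p q"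
    unfolding mem_Pi_plane vector_add_component by (intro conjI) algebra+
next
  fix c x assume "x \<in> Pi_plane \<eta> p q"
  then show "c *s x \<in> Pi_plane \<eta> p q"
    unfolding mem_Pi_plane vector_smult_component by (intro conjI) algebra+
qed

lemma subspace_Lambda_plane: "vec.subspace (Lambda_plane \<eta> \<zeta> p q r s t)"
proof (rule vec.subspaceI)
  show "0 \<in> Lambda_plane \<eta> \<zeta> p q r s t" by (simp add: mem_Lambda_plane)
next
  fix x y assume "x \<in> Lambda_plane \<eta> \<zeta> p q r s t" "y \<in> Lambda_plane \<eta> \<zeta> p q r s t"
  then show "x + y \<in> Lambda_plane \<eta> \<zeta> p q r s t"
    unfolding mem_Lambda_plane vector_add_component by (intro conjI) algebra+
next
  fix c x assume "x \<in> Lambda_plane \<eta> \<zeta> p q r s t"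
  then show "c *s x \<in> Lambda_plane \<eta> \<zeta> p q r s t"
    unfolding mem_Lambda_plane vector_smult_component by (intro conjI) algebra+
qed

end

locale burkhardt = frame +
  fixes \<eta> \<zeta> :: complex
  assumes eta_sq: "\<eta>\<^sup>2 = -3" and zeta_def: "\<zeta> = (-1 + \<eta>) / 2"
begin

lemma zeta_sq: "\<zeta>\<^sup>2 = - 1 - \<zeta>"
  using eta_sq unfolding zeta_def by (simp add: power2_eq_square field_simps)

lemma eta_eq: "\<eta> = 1 + 2 * \<zeta>"
  unfolding zeta_def by (simp add: field_simps)

text \<open>With e_k the elementary symmetric polynomials in \<open>u_r\<close>, \<open>u_s\<close>,
  \<open>u_t\<close>, the product of \<open>u_r + \<zeta> u_s + \<zeta>\<^sup>2 u_t\<close> with its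
  conjugate (\<zeta> and its square exchanged) is e_1^2 - 3 e_2. On the plane e_1 = \<eta> a, so
  this equals -3 (a^2 + e_2).\<close>

lemma Lambda_quadratic_eq_0:
  assumes "x \<in> Lambda_plane \<eta> \<zeta> p q r s t"
  shows "(x $ 0)\<^sup>2 + (x $ r * x $ s + x $ r * x $ t + x $ s * x $ t) = 0"
  using assms eta_sq zeta_sq unfolding mem_Lambda_plane by algebra

text \<open>For \<open>u_q = - u_p\<close> the form is (a^2 - u_p^2)(a^2 + e_2), with e_2 taken in
  \<open>u_r\<close>, \<open>u_s\<close>, \<open>u_t\<close>, and the second factor vanishes on the
  plane.\<close>

lemma Lambda_subset_X: "Lambda_plane \<eta> \<zeta> p q r s t \<subseteq> X_quartic \<eta>"
proof
  fix x assume x: "x \<in> Lambda_plane \<eta> \<zeta> p q r s t"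
  then have "quartic_form x = 0"
    using Lambda_quadratic_eq_0[OF x] x unfolding mem_Lambda_plane quartic_frame by algebra
  moreover have "x \<in> L_hyp \<eta>" using x by (simp add: Lambda_plane_def)
  ultimately show "x \<in> X_quartic \<eta>" by (simp add: X_quartic_def)
qed

lemma Pi_subset_X: "Pi_plane \<eta> p q \<subseteq> X_quartic \<eta>"
proof
  fix x assume x: "x \<in> Pi_plane \<eta> p q"
  then have "quartic_form x = 0"
    unfolding mem_Pi_plane quartic_frame by algebra
  moreover have "x \<in> L_hyp \<eta>" using x by (simp add: Pi_plane_def)
  ultimately show "x \<in> X_quartic \<eta>" by (simp add: X_quartic_def)
qed

lemma dim_Pi_plane: "vec.dim (Pi_plane \<eta> p q) = 3"
  by (rule dim_eq_3I[of "pt 1 (-1) 1 0 0 \<eta>" _ "pt 0 0 0 1 0 (-1)" "pt 0 0 0 0 1 (-1)" 0 r s])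
    (auto simp: mem_Pi_plane vec_eq_frame algebra_simps)

lemma dim_Lambda_plane: "vec.dim (Lambda_plane \<eta> \<zeta> p q r s t) = 3"
\<comment> \<open>The free coordinates are \<open>u_p\<close>, \<open>u_s\<close>,
  \<open>u_t\<close>: the \<zeta>-equation determines \<open>u_r\<close>, and then a = (u_r + u_s +
  u_t) / \<eta>.\<close>
proof (rule dim_eq_3I[of "pt 0 1 (-1) 0 0 0" _
      "pt ((1 - \<zeta>) / \<eta>) 0 0 (- \<zeta>) 1 0" "pt ((1 - \<zeta>\<^sup>2) / \<eta>) 0 0 (- \<zeta>\<^sup>2) 0 1" p s t])
  have [simp]: "\<eta> \<noteq> 0" using eta_sq by auto
  show "pt ((1 - \<zeta>) / \<eta>) 0 0 (- \<zeta>) 1 0 \<in> Lambda_plane \<eta> \<zeta> p q r s t"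
       "pt ((1 - \<zeta>\<^sup>2) / \<eta>) 0 0 (- \<zeta>\<^sup>2) 0 1 \<in> Lambda_plane \<eta> \<zeta> p q r s t"
       "pt 0 1 (-1) 0 0 0 \<in> Lambda_plane \<eta> \<zeta> p q r s t"
    by (simp_all add: mem_Lambda_plane)
  fix x assume x: "x \<in> Lambda_plane \<eta> \<zeta> p q r s t"
  then have "x $ r = - \<zeta> * x $ s - \<zeta>\<^sup>2 * x $ t" unfolding mem_Lambda_plane by algebra
  moreover from this x have "\<eta> * x $ 0 = (1 - \<zeta>) * x $ s + (1 - \<zeta>\<^sup>2) * x $ t"
    unfolding mem_Lambda_plane by algebra
  then have "x $ 0 = ((1 - \<zeta>) * x $ s + (1 - \<zeta>\<^sup>2) * x $ t) / \<eta>"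
    by (simp add: eq_divide_eq mult.commute)
  then have "x $ 0 = ((1 - \<zeta>) / \<eta>) * x $ s + ((1 - \<zeta>\<^sup>2) / \<eta>) * x $ t"
    by (simp add: add_divide_distrib)
  ultimately show "x = x $ p *s pt 0 1 (-1) 0 0 0 + x $ s *s pt ((1 - \<zeta>) / \<eta>) 0 0 (- \<zeta>) 1 0
      + x $ t *s pt ((1 - \<zeta>\<^sup>2) / \<eta>) 0 0 (- \<zeta>\<^sup>2) 0 1"
    using x unfolding mem_Lambda_plane by (simp add: vec_eq_frame algebra_simps)
qed simp_all

text \<open>
  From \<open>F = (a + u\<^sub>p) G + (a - u\<^sub>q) \<Prod>\<^sub>k (a - u\<^sub>k)\<close> with \<open>k \<in> {r, s, t}\<close>, where \<open>G\<close> restricts to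
  \<open>\<Prod>\<^sub>k (a + u\<^sub>k)\<close> on the plane.
\<close>

lemma dir_deriv_Pi:
  assumes "x \<in> Pi_plane \<eta> p q"
  shows "dir_deriv quartic_form v x =
    (x $ 0 + x $ r) * (x $ 0 + x $ s) * (x $ 0 + x $ t) * (v $ 0 + v $ p) +
    (x $ 0 - x $ r) * (x $ 0 - x $ s) * (x $ 0 - x $ t) * (v $ 0 - v $ q)"
  using assms unfolding mem_Pi_plane dir_deriv_frame by algebra

text \<open>Put l = u_p + u_q, let m be the \<zeta>-form of the plane and m' its conjugate, and take
  e_k in \<open>u_r\<close>, \<open>u_s\<close>, \<open>u_t\<close>. The form is (a^2 + u_p u_q)(a^2
  + e_2) + l (a^2 e_1 + e_3), and 3 (a^2 + e_2) = l^2 - 2 \<eta> a l - m m' on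
  \<open>L_hyp \<eta>\<close>. Differentiating at l = m = 0 gives the two cubics; the factor 3
  clears denominators.\<close>

lemma dir_deriv_Lambda:
  assumes "x \<in> Lambda_plane \<eta> \<zeta> p q r s t" "v \<in> L_hyp \<eta>"
  shows "3 * dir_deriv quartic_form v x =
    ((x $ p)\<^sup>2 - (x $ 0)\<^sup>2) * (x $ r + \<zeta>\<^sup>2 * x $ s + \<zeta> * x $ t) * (v $ r + \<zeta> * v $ s + \<zeta>\<^sup>2 * v $ t) +
    (\<eta> * x $ 0 * ((x $ 0)\<^sup>2 + 2 * (x $ p)\<^sup>2) + 3 * (x $ r * x $ s * x $ t)) * (v $ p + v $ q)"
  using assms Lambda_quadratic_eq_0[OF assms(1)] eta_eq zeta_sq
  unfolding mem_Lambda_plane L_hyp_frame dir_deriv_frame by algebra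
end

section \<open>Nodality of the three types of points\<close>

context burkhardt
begin

lemma node_atI:
  assumes "x \<in> L_hyp \<eta>" "x \<noteq> 0" "quartic_form x = 0"
    and "\<And>v. v \<in> L_hyp \<eta> \<Longrightarrow> dir_deriv quartic_form v x = 0"
    and radical: "\<And>v. v \<in> L_hyp \<eta> \<Longrightarrow>
      (\<And>w. w \<in> L_hyp \<eta> \<Longrightarrow> dir_deriv (dir_deriv quartic_form w) v x = 0) \<Longrightarrow> \<exists>c. v = c *s x"
  shows "node_at quartic_form (L_hyp \<eta>) x"
  unfolding node_at_def singular_at_def vec.span_singleton using assms by blast

lemma eta_4: "\<eta> ^ 4 = 9"
  using eta_sq by algebra

text \<open>Test vectors \<open>w\<close> for the Hessian. They form a basis of the hyperplane, so
  pairing with them captures the whole radical condition.\<close>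

lemma L_hyp_basis:
  "pt 0 1 (-1) 0 0 0 \<in> L_hyp \<eta>" "pt 0 1 0 (-1) 0 0 \<in> L_hyp \<eta>" "pt 0 1 0 0 (-1) 0 \<in> L_hyp \<eta>"
  "pt 0 1 0 0 0 (-1) \<in> L_hyp \<eta>" "pt 1 0 0 0 0 \<eta> \<in> L_hyp \<eta>"
  unfolding L_hyp_frame by simp_all

text \<open>One representative per type suffices, the others arise by renumbering the frame. The
  five Hessian equations and the hyperplane equation form a linear system for \<open>v\<close> whose
  solutions are the multiples of the point.\<close>

lemma node_R: "node_at quartic_form (L_hyp \<eta>) (pt 1 (-1) (-1) 1 1 \<eta>)"
proof (rule node_atI)
  fix v assume v: "v \<in> L_hyp \<eta>"
  show "dir_deriv quartic_form v (pt 1 (-1) (-1) 1 1 \<eta>) = 0"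
    using v eta_sq unfolding L_hyp_frame dir_deriv_frame pt_nth
    by (simp add: power2_eq_square power3_eq_cube field_simps)
  assume "\<And>w. w \<in> L_hyp \<eta> \<Longrightarrow> dir_deriv (dir_deriv quartic_form w) v (pt 1 (-1) (-1) 1 1 \<eta>) = 0"
  note h = L_hyp_basis[THEN this, unfolded hessian_frame pt_nth]
  have "v $ p = - v $ 0 \<and> v $ q = - v $ 0 \<and> v $ r = v $ 0 \<and> v $ s = v $ 0 \<and> v $ t = v $ 0 * \<eta>"
    by (insert h v[unfolded L_hyp_frame] eta_sq)
      (simp add: power2_eq_square algebra_simps; intro conjI; algebra)
  then show "\<exists>c. v = c *s pt 1 (-1) (-1) 1 1 \<eta>"
    by (intro exI[of _ "v $ 0"]) (simp add: vec_eq_frame)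
qed (use eta_sq in \<open>simp_all add: vec_eq_frame L_hyp_frame quartic_frame power2_eq_square\<close>)

lemma node_T: "node_at quartic_form (L_hyp \<eta>) (pt 0 1 (-1) 0 0 0)"
proof (rule node_atI)
  fix v assume v: "v \<in> L_hyp \<eta>"
  show "dir_deriv quartic_form v (pt 0 1 (-1) 0 0 0) = 0"
    using v eta_sq unfolding L_hyp_frame dir_deriv_frame pt_nth
    by (simp add: power2_eq_square power3_eq_cube field_simps)
  assume "\<And>w. w \<in> L_hyp \<eta> \<Longrightarrow> dir_deriv (dir_deriv quartic_form w) v (pt 0 1 (-1) 0 0 0) = 0"
  note h = L_hyp_basis[THEN this, unfolded hessian_frame pt_nth]
  have "v $ q = - v $ p \<and> v $ r = 0 \<and> v $ s = 0 \<and> v $ t = 0 \<and> v $ 0 = 0"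
    by (insert h v[unfolded L_hyp_frame] eta_sq)
      (simp add: power2_eq_square algebra_simps; intro conjI; algebra)
  then show "\<exists>c. v = c *s pt 0 1 (-1) 0 0 0"
    by (intro exI[of _ "v $ p"]) (simp add: vec_eq_frame)
qed (use eta_sq in \<open>simp_all add: vec_eq_frame L_hyp_frame quartic_frame power2_eq_square\<close>)

text \<open>The point \<open>E\<^sub>p\<close>, rescaled by \<open>-3/\<eta> = \<eta>\<close> to clear denominators.\<close>

lemma node_E: "node_at quartic_form (L_hyp \<eta>) (pt \<eta> 1 (-1) (-1) (-1) (-1))"
  (is "node_at _ _ ?E")
proof (rule node_atI)
  fix v assume v: "v \<in> L_hyp \<eta>"
  show "dir_deriv quartic_form v ?E = 0"
    using v eta_sq unfolding L_hyp_frame dir_deriv_frame pt_nth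
    by (simp add: power2_eq_square power3_eq_cube field_simps, algebra)
  assume "\<And>w. w \<in> L_hyp \<eta> \<Longrightarrow> dir_deriv (dir_deriv quartic_form w) v ?E = 0"
  note h = L_hyp_basis[THEN this, unfolded hessian_frame pt_nth]
  have "v $ q = - v $ p \<and> v $ r = - v $ p \<and> v $ s = - v $ p \<and> v $ t = - v $ p \<and> v $ 0 = v $ p * \<eta>"
    by (insert h v[unfolded L_hyp_frame] eta_sq)
      (simp add: power2_eq_square algebra_simps; intro conjI; algebra)
  then show "\<exists>c. v = c *s ?E"
    by (intro exI[of _ "v $ p"]) (simp add: vec_eq_frame)
qed (use eta_sq in \<open>simp_all add: vec_eq_frame L_hyp_frame quartic_frame eta_4 power2_eq_square\<close>)

text \<open>Since \<open>pt\<close> depends on the frame, the node is described by its coordinates;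
  in this form the lemma can be used in a permuted frame.\<close>

lemma node_RI:
  assumes "x $ 0 = 1" "x $ p = - 1" "x $ q = - 1" "x $ r = 1" "x $ s = 1" "x $ t = \<eta>"
  shows "node_at quartic_form (L_hyp \<eta>) x"
proof -
  have "x = pt 1 (-1) (-1) 1 1 \<eta>" using assms by (simp add: vec_eq_frame)
  then show ?thesis using node_R by simp
qed

lemma node_TI:
  assumes "x $ 0 = 0" "x $ p = 1" "x $ q = - 1" "x $ r = 0" "x $ s = 0" "x $ t = 0"
  shows "node_at quartic_form (L_hyp \<eta>) x"
proof -
  have "x = pt 0 1 (-1) 0 0 0" using assms by (simp add: vec_eq_frame)
  then show ?thesis using node_T by simp
qed

lemma node_EI:
  assumes "x $ 0 = \<eta>" "x $ p = 1" "x $ q = - 1" "x $ r = - 1" "x $ s = - 1" "x $ t = - 1"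
  shows "node_at quartic_form (L_hyp \<eta>) x"
proof -
  have "x = pt \<eta> 1 (-1) (-1) (-1) (-1)" using assms by (simp add: vec_eq_frame)
  then show ?thesis using node_E by simp
qed

end

section \<open>Counting the nodes in a plane by representatives\<close>

lemma span_singleton_scale:
  fixes x :: "'a::field ^ 'n"
  assumes "c \<noteq> 0"
  shows "vec.span {c *s x} = vec.span {x}"
proof (rule vec.span_eq[THEN iffD2], intro conjI)
  have "x = inverse c *s (c *s x)" using assms by simp
  then have "x \<in> vec.span {c *s x}" by (metis insertI1 vec.span_base vec.span_scale)
  then show "{x} \<subseteq> vec.span {c *s x}" by simp
qed (simp add: vec.span_base vec.span_scale)

text \<open>The map from vectors to the lines they span is a bijection from \<open>S\<close> onto
  the nodes in \<open>P\<close>: onto by \<open>cover\<close>, which treats all singular points at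
  once, and injective by \<open>distinct\<close>.\<close>

lemma card_nodes_in_plane:
  assumes P: "vec.subspace P" and S: "finite S" "S \<subseteq> P" "\<And>y. y \<in> S \<Longrightarrow> node_at quartic_form (L_hyp \<eta>) y"
    and cover: "\<And>x. x \<in> P \<Longrightarrow> singular_at quartic_form (L_hyp \<eta>) x \<Longrightarrow> \<exists>y\<in>S. \<exists>c. x = c *s y"
    and distinct: "\<And>x y c. x \<in> S \<Longrightarrow> y \<in> S \<Longrightarrow> x = c *s y \<Longrightarrow> x = y"
  shows "card {N \<in> X_nodes \<eta>. N \<subseteq> P} = card S"
proof -
  have "{N \<in> X_nodes \<eta>. N \<subseteq> P} = (\<lambda>x. vec.span {x}) ` S"
  proof (intro set_eqI iffI)
    fix N assume "N \<in> {N \<in> X_nodes \<eta>. N \<subseteq> P}"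
    then obtain x where x: "N = vec.span {x}" "node_at quartic_form (L_hyp \<eta>) x" "N \<subseteq> P"
      unfolding X_nodes_def by blast
    then have sing: "singular_at quartic_form (L_hyp \<eta>) x" and "x \<in> P"
      using vec.span_base[of x "{x}"] unfolding node_at_def by blast+
    with cover obtain y c where y: "y \<in> S" "x = c *s y" by blast
    moreover have "c \<noteq> 0" using sing y by (auto simp: singular_at_def)
    ultimately show "N \<in> (\<lambda>x. vec.span {x}) ` S"
      using x span_singleton_scale by blast
  next
    fix N assume "N \<in> (\<lambda>x. vec.span {x}) ` S"
    then obtain y where y: "y \<in> S" "N = vec.span {y}" by blast
    then have "N \<subseteq> P" using S(2) P vec.span_minimal[of "{y}" P] by blast
    then show "N \<in> {N \<in> X_nodes \<eta>. N \<subseteq> P}"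
      using S(3) y unfolding X_nodes_def by blast
  qed
  moreover have "inj_on (\<lambda>x. vec.span {x}) S"
  proof (rule inj_onI)
    fix x y assume "x \<in> S" "y \<in> S" "vec.span {x} = vec.span {y}"
    moreover from this(3) have "x \<in> range (\<lambda>c. c *s y)"
      unfolding vec.span_singleton[symmetric] by (metis insertI1 vec.span_base)
    ultimately show "x = y" using distinct by blast
  qed
  ultimately show ?thesis by (simp add: card_image)
qed

section \<open>The nine nodes on each plane\<close>

context burkhardt
begin

text \<open>The renumberings that bring the listed nodes into normal form. The first six place
  \<open>p\<close> in A and \<open>q\<close> in B for the nodes R_{A,B;c}; the seventh exchanges
  \<open>p\<close> and \<open>q\<close>; the last three serve the nodes T_C with C inside {r, s,
  t}.\<close>

lemma frame_perms:
  "burkhardt p r q s t \<eta> \<zeta>" "burkhardt p r q t s \<eta> \<zeta>" "burkhardt p s q r t \<eta> \<zeta>"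
  "burkhardt p s q t r \<eta> \<zeta>" "burkhardt p t q r s \<eta> \<zeta>" "burkhardt p t q s r \<eta> \<zeta>"
  "burkhardt q p r s t \<eta> \<zeta>" "burkhardt r s p q t \<eta> \<zeta>" "burkhardt r t p q s \<eta> \<zeta>"
  "burkhardt s t p q r \<eta> \<zeta>"
  by (unfold_locales, use dist ix eta_sq zeta_def in \<open>auto simp: insert_commute\<close>)+

lemma eta_ne: "\<eta> \<noteq> 0" "\<eta> \<noteq> 1" "\<eta> \<noteq> - 1" "1 \<noteq> \<eta>" "- 1 \<noteq> \<eta>"
  using eta_sq by auto

text \<open>The six R_{A,B;c} with \<open>p\<close> in A and \<open>q\<close> in B, and the three
  T_C with C inside {r, s, t}.\<close>

definition Pi_nodes :: "(complex ^ 6) set" where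
  "Pi_nodes = {pt 1 (-1) 1 1 (-1) \<eta>, pt 1 (-1) 1 (-1) 1 \<eta>, pt 1 (-1) 1 1 \<eta> (-1),
    pt 1 (-1) 1 (-1) \<eta> 1, pt 1 (-1) 1 \<eta> 1 (-1), pt 1 (-1) 1 \<eta> (-1) 1,
    pt 0 0 0 1 (-1) 0, pt 0 0 0 1 0 (-1), pt 0 0 0 0 1 (-1)}"

text \<open>The R_{A,B;c} with \<open>(u_r, u_s, u_t)\<close> a cyclic rotation of (\<eta>, -1, 1)
  and either sign of \<open>u_p\<close>, the node T_C with C = {p, q}, and \<open>E_p\<close>,
  \<open>E_q\<close> rescaled by \<eta>.\<close>

definition Lambda_nodes :: "(complex ^ 6) set" where
  "Lambda_nodes = {pt 1 1 (-1) \<eta> (-1) 1, pt 1 1 (-1) 1 \<eta> (-1), pt 1 1 (-1) (-1) 1 \<eta>,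
    pt 1 (-1) 1 \<eta> (-1) 1, pt 1 (-1) 1 1 \<eta> (-1), pt 1 (-1) 1 (-1) 1 \<eta>,
    pt 0 1 (-1) 0 0 0, pt \<eta> 1 (-1) (-1) (-1) (-1), pt \<eta> (-1) 1 (-1) (-1) (-1)}"

lemma card_Pi_nodes: "card Pi_nodes = 9"
  unfolding Pi_nodes_def by (simp add: card_insert_if eta_ne)

lemma card_Lambda_nodes: "card Lambda_nodes = 9"
  unfolding Lambda_nodes_def by (simp add: card_insert_if eta_ne)

lemma node_perm_RI:
  assumes "x $ 0 = 1" "x $ p = - 1" "x $ q = 1"
    "x $ r = 1 \<and> x $ s = - 1 \<and> x $ t = \<eta> \<or> x $ r = - 1 \<and> x $ s = 1 \<and> x $ t = \<eta> \<or>
     x $ r = 1 \<and> x $ s = \<eta> \<and> x $ t = - 1 \<or> x $ r = - 1 \<and> x $ s = \<eta> \<and> x $ t = 1 \<or>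
     x $ r = \<eta> \<and> x $ s = 1 \<and> x $ t = - 1 \<or> x $ r = \<eta> \<and> x $ s = - 1 \<and> x $ t = 1"
  shows "node_at quartic_form (L_hyp \<eta>) x"
  using assms by (elim disjE conjE) (simp_all add: frame_perms(1-6)[THEN burkhardt.node_RI])

lemma Pi_nodes_node: "y \<in> Pi_nodes \<Longrightarrow> node_at quartic_form (L_hyp \<eta>) y"
  unfolding Pi_nodes_def
  by (elim insertE emptyE; hypsubst)
    (simp_all add: node_perm_RI frame_perms[THEN burkhardt.node_TI])

lemma Lambda_nodes_node: "y \<in> Lambda_nodes \<Longrightarrow> node_at quartic_form (L_hyp \<eta>) y"
  unfolding Lambda_nodes_def
  by (elim insertE emptyE; hypsubst)
    (simp_all add: node_perm_RI frame_perms(7)[THEN burkhardt.node_perm_RI]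
      node_T node_E frame_perms(7)[THEN burkhardt.node_EI])

lemma Pi_nodes_distinct:
  "x \<in> Pi_nodes \<Longrightarrow> y \<in> Pi_nodes \<Longrightarrow> x = c *s y \<Longrightarrow> x = y"
  unfolding Pi_nodes_def using eta_ne
  by (elim insertE emptyE; hypsubst) (auto simp: vec_eq_frame)

lemma Lambda_nodes_distinct:
  "x \<in> Lambda_nodes \<Longrightarrow> y \<in> Lambda_nodes \<Longrightarrow> x = c *s y \<Longrightarrow> x = y"
  unfolding Lambda_nodes_def using eta_ne
  by (elim insertE emptyE; hypsubst) (auto simp: vec_eq_frame)

lemma Pi_nodes_subset: "Pi_nodes \<subseteq> Pi_plane \<eta> p q"
  unfolding Pi_nodes_def by (simp add: mem_Pi_plane)

lemma Lambda_nodes_subset: "Lambda_nodes \<subseteq> Lambda_plane \<eta> \<zeta> p q r s t"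
proof -
  \<comment> \<open>The \<zeta>-equation at the three rotations of (\<eta>, -1, 1) and at
    \<open>E_p\<close>, \<open>E_q\<close>; the last identity is the hyperplane equation at
    \<open>E_p\<close>, \<open>E_q\<close>.\<close>
  have "\<eta> - \<zeta> + \<zeta>\<^sup>2 = 0" "1 + \<zeta> * \<eta> - \<zeta>\<^sup>2 = 0" "- 1 + \<zeta> + \<zeta>\<^sup>2 * \<eta> = 0"
    "- 1 - \<zeta> - \<zeta>\<^sup>2 = 0" "- 3 = \<eta> * \<eta>"
    using eta_eq zeta_sq by algebra+
  then show ?thesis
    unfolding Lambda_nodes_def by (simp add: mem_Lambda_plane)
qed

lemma Pi_nodes_cover:
  assumes x: "x \<in> Pi_plane \<eta> p q" and sing: "singular_at quartic_form (L_hyp \<eta>) x"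
  shows "\<exists>y\<in>Pi_nodes. \<exists>c. x = c *s y"
proof -
  have D: "dir_deriv quartic_form v x = 0" if "v \<in> L_hyp \<eta>" for v
    using that sing by (simp add: singular_at_def)
  \<comment> \<open>The first direction changes only the equation \<open>a + u_p\<close>, the second
    only \<open>a - u_q\<close>, so each isolates one of the two cubics of
    \<open>dir_deriv_Pi\<close>.\<close>
  have "pt 0 1 0 (-1) 0 0 \<in> L_hyp \<eta>" "pt 0 0 1 (-1) 0 0 \<in> L_hyp \<eta>"
    by (simp_all add: L_hyp_frame)
  from this[THEN D, unfolded dir_deriv_Pi[OF x]]
  have "x $ 0 + x $ r = 0 \<or> x $ 0 + x $ s = 0 \<or> x $ 0 + x $ t = 0"
    and "x $ 0 - x $ r = 0 \<or> x $ 0 - x $ s = 0 \<or> x $ 0 - x $ t = 0"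
    by simp_all
  \<comment> \<open>A repeated index forces a = 0 and leads to a node T_C; two different indices
    lead to a node R_{A,B;c}, whose last coordinate is \<eta> a.\<close>
  then consider "x $ 0 + x $ r = 0" "x $ 0 - x $ r = 0" | "x $ 0 + x $ s = 0" "x $ 0 - x $ s = 0"
    | "x $ 0 + x $ t = 0" "x $ 0 - x $ t = 0"
    | "x $ 0 + x $ r = 0" "x $ 0 - x $ s = 0" | "x $ 0 + x $ r = 0" "x $ 0 - x $ t = 0"
    | "x $ 0 + x $ s = 0" "x $ 0 - x $ r = 0" | "x $ 0 + x $ s = 0" "x $ 0 - x $ t = 0"
    | "x $ 0 + x $ t = 0" "x $ 0 - x $ r = 0" | "x $ 0 + x $ t = 0" "x $ 0 - x $ s = 0"
    by blast
  then show ?thesis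
  proof cases
    case 1
    then have "x = x $ s *s pt 0 0 0 0 1 (-1)"
      using x[unfolded mem_Pi_plane] by (simp add: vec_eq_frame) algebra
    then show ?thesis by (auto simp: Pi_nodes_def)
  next
    case 2
    then have "x = x $ r *s pt 0 0 0 1 0 (-1)"
      using x[unfolded mem_Pi_plane] by (simp add: vec_eq_frame) algebra
    then show ?thesis by (auto simp: Pi_nodes_def)
  next
    case 3
    then have "x = x $ r *s pt 0 0 0 1 (-1) 0"
      using x[unfolded mem_Pi_plane] by (simp add: vec_eq_frame) algebra
    then show ?thesis by (auto simp: Pi_nodes_def)
  next
    case 4
    then have "x = x $ 0 *s pt 1 (-1) 1 (-1) 1 \<eta>"
      using x[unfolded mem_Pi_plane] by (simp add: vec_eq_frame) algebra
    then show ?thesis by (auto simp: Pi_nodes_def)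
  next
    case 5
    then have "x = x $ 0 *s pt 1 (-1) 1 (-1) \<eta> 1"
      using x[unfolded mem_Pi_plane] by (simp add: vec_eq_frame) algebra
    then show ?thesis by (auto simp: Pi_nodes_def)
  next
    case 6
    then have "x = x $ 0 *s pt 1 (-1) 1 1 (-1) \<eta>"
      using x[unfolded mem_Pi_plane] by (simp add: vec_eq_frame) algebra
    then show ?thesis by (auto simp: Pi_nodes_def)
  next
    case 7
    then have "x = x $ 0 *s pt 1 (-1) 1 \<eta> (-1) 1"
      using x[unfolded mem_Pi_plane] by (simp add: vec_eq_frame) algebra
    then show ?thesis by (auto simp: Pi_nodes_def)
  next
    case 8
    then have "x = x $ 0 *s pt 1 (-1) 1 1 \<eta> (-1)"
      using x[unfolded mem_Pi_plane] by (simp add: vec_eq_frame) algebra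
    then show ?thesis by (auto simp: Pi_nodes_def)
  next
    case 9
    then have "x = x $ 0 *s pt 1 (-1) 1 \<eta> 1 (-1)"
      using x[unfolded mem_Pi_plane] by (simp add: vec_eq_frame) algebra
    then show ?thesis by (auto simp: Pi_nodes_def)
  qed
qed

lemma Lambda_nodes_cover:
  assumes x: "x \<in> Lambda_plane \<eta> \<zeta> p q r s t" and sing: "singular_at quartic_form (L_hyp \<eta>) x"
  shows "\<exists>y\<in>Lambda_nodes. \<exists>c. x = c *s y"
proof -
  have D: "3 * dir_deriv quartic_form v x = 0" if "v \<in> L_hyp \<eta>" for v
    using that sing by (simp add: singular_at_def)
  \<comment> \<open>The first direction keeps \<open>u_p + u_q\<close> and changes the \<zeta>-form
    by 1 - \<zeta>; the second keeps the \<zeta>-form and changes \<open>u_p + u_q\<close> by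
    \<eta>.\<close>
  have L: "pt 0 0 0 1 (-1) 0 \<in> L_hyp \<eta>" "pt 1 \<eta> 0 0 0 0 \<in> L_hyp \<eta>"
    by (simp_all add: L_hyp_frame)
  note D' = L[THEN D, unfolded dir_deriv_Lambda[OF x L(1)] dir_deriv_Lambda[OF x L(2)]]
  have "\<zeta> \<noteq> 1" using zeta_sq by auto
  with D'(1) have D1: "(x $ p)\<^sup>2 = (x $ 0)\<^sup>2 \<or> x $ r + \<zeta>\<^sup>2 * x $ s + \<zeta> * x $ t = 0"
    by simp
  from D'(2) eta_ne have D2: "\<eta> * x $ 0 * ((x $ 0)\<^sup>2 + 2 * (x $ p)\<^sup>2) + 3 * (x $ r * x $ s * x $ t) = 0"
    by simp
  note x' = x[unfolded mem_Lambda_plane]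
  from D1 show ?thesis
  proof
    assume l: "x $ r + \<zeta>\<^sup>2 * x $ s + \<zeta> * x $ t = 0"
    \<comment> \<open>Both \<zeta>-forms vanish, so the three coordinates agree, and their sum is
      \<eta> a. The remaining cubic becomes a multiple of a (a^2 + 3 u_p^2), which splits because
      \<eta>^2 = -3.\<close>
    have rst: "x $ s = x $ r" "x $ t = x $ r" "3 * x $ r = \<eta> * x $ 0"
      using x' l zeta_sq by algebra+
    have "\<eta> * x $ 0 * ((x $ 0)\<^sup>2 + 2 * (x $ p)\<^sup>2) + 3 * (x $ r * x $ r * x $ r) = 0"
      using D2 unfolding rst(1,2) .
    then have "\<eta> * (x $ 0 * (x $ 0 - \<eta> * x $ p) * (x $ 0 + \<eta> * x $ p)) = 0"
      using rst(3) eta_sq by algebra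
    then have "x $ 0 * (x $ 0 - \<eta> * x $ p) * (x $ 0 + \<eta> * x $ p) = 0"
      using eta_ne by simp
    then consider "x $ 0 = 0" | "x $ 0 - \<eta> * x $ p = 0" | "x $ 0 + \<eta> * x $ p = 0" by auto
    then show ?thesis
    proof cases
      case 1
      then have "x = x $ p *s pt 0 1 (-1) 0 0 0"
        using x' rst by (simp add: vec_eq_frame)
      then show ?thesis by (auto simp: Lambda_nodes_def)
    next
      case 2
      then have "x $ 0 = \<eta> * x $ p" "x $ r = - x $ p"
        using rst(3) eta_sq by algebra+
      then have "x = x $ p *s pt \<eta> 1 (-1) (-1) (-1) (-1)"
        using rst(1,2) x'[THEN conjunct1]
        by (simp add: vec_eq_frame mult.commute)
      then show ?thesis by (auto simp: Lambda_nodes_def)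
    next
      case 3
      then have "x $ 0 = - \<eta> * x $ p" "x $ r = x $ p"
        using rst(3) eta_sq by algebra+
      then have "x = x $ q *s pt \<eta> (-1) 1 (-1) (-1) (-1)"
        using rst(1,2) x'[THEN conjunct1]
        by (simp add: vec_eq_frame mult.commute)
      then show ?thesis by (auto simp: Lambda_nodes_def)
    qed
  next
    assume pa: "(x $ p)\<^sup>2 = (x $ 0)\<^sup>2"
    \<comment> \<open>A discrete Fourier coefficient: with the other \<zeta>-form zero and the sum
      \<eta> a, the inverse transform expresses the coordinates by \<open>y\<close> and a. Then 27
      u_r u_s u_t = (\<eta> a)^3 + y^3, and the cubic turns into y^3 = (2 \<eta> a)^3.\<close>
    define y where "y = x $ r + \<zeta>\<^sup>2 * x $ s + \<zeta> * x $ t"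
    have rst: "3 * x $ r = \<eta> * x $ 0 + y" "3 * x $ s = \<eta> * x $ 0 + \<zeta> * y" "3 * x $ t = \<eta> * x $ 0 + \<zeta>\<^sup>2 * y"
      using x' zeta_sq y_def by algebra+
    have "(y - 2 * \<eta> * x $ 0) * (y - 2 * \<eta> * \<zeta> * x $ 0) * (y - 2 * \<eta> * \<zeta>\<^sup>2 * x $ 0) = 0"
      using D2 pa rst zeta_sq eta_eq by algebra
    then have y: "y = 2 * \<eta> * x $ 0 \<or> y = 2 * \<eta> * \<zeta> * x $ 0 \<or> y = 2 * \<eta> * \<zeta>\<^sup>2 * x $ 0"
      by auto
    have "(x $ p - x $ 0) * (x $ p + x $ 0) = 0" using pa by algebra
    then have "x $ p = x $ 0 \<or> x $ p = - x $ 0" by (auto simp: eq_neg_iff_add_eq_0)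
    moreover have
      "x $ r = \<eta> * x $ 0 \<and> x $ s = - x $ 0 \<and> x $ t = x $ 0 \<or>
       x $ r = x $ 0 \<and> x $ s = \<eta> * x $ 0 \<and> x $ t = - x $ 0 \<or>
       x $ r = - x $ 0 \<and> x $ s = x $ 0 \<and> x $ t = \<eta> * x $ 0"
      using y
    proof (elim disjE)
      assume "y = 2 * \<eta> * x $ 0"
      then have "x $ r = \<eta> * x $ 0" "x $ s = - x $ 0" "x $ t = x $ 0"
        using rst zeta_sq eta_eq by algebra+
      then show ?thesis by simp
    next
      assume "y = 2 * \<eta> * \<zeta> * x $ 0"
      then have "x $ r = - x $ 0" "x $ s = x $ 0" "x $ t = \<eta> * x $ 0"
        using rst zeta_sq eta_eq by algebra+
      then show ?thesis by simp
    next
      assume "y = 2 * \<eta> * \<zeta>\<^sup>2 * x $ 0"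
      then have "x $ r = x $ 0" "x $ s = \<eta> * x $ 0" "x $ t = - x $ 0"
        using rst zeta_sq eta_eq by algebra+
      then show ?thesis by simp
    qed
    ultimately have "\<exists>y\<in>Lambda_nodes. x = x $ 0 *s y"
      using x' unfolding Lambda_nodes_def by (elim disjE conjE) (simp_all add: vec_eq_frame mult.commute)
    then show ?thesis by blast
  qed
qed

lemma jacobi_plane_Pi: "jacobi_plane \<eta> (Pi_plane \<eta> p q)"
proof -
  have "card {N \<in> X_nodes \<eta>. N \<subseteq> Pi_plane \<eta> p q} = card Pi_nodes"
  proof (rule card_nodes_in_plane)
    show "finite Pi_nodes" by (simp add: Pi_nodes_def)
  qed (rule subspace_Pi_plane Pi_nodes_subset Pi_nodes_node Pi_nodes_cover Pi_nodes_distinct; assumption)+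
  then show ?thesis
    by (simp add: jacobi_plane_def proj_plane_def subspace_Pi_plane dim_Pi_plane Pi_subset_X card_Pi_nodes)
qed

lemma jacobi_plane_Lambda: "jacobi_plane \<eta> (Lambda_plane \<eta> \<zeta> p q r s t)"
proof -
  have "card {N \<in> X_nodes \<eta>. N \<subseteq> Lambda_plane \<eta> \<zeta> p q r s t} = card Lambda_nodes"
  proof (rule card_nodes_in_plane)
    show "finite Lambda_nodes" by (simp add: Lambda_nodes_def)
  qed (rule subspace_Lambda_plane Lambda_nodes_subset Lambda_nodes_node Lambda_nodes_cover Lambda_nodes_distinct; assumption)+
  then show ?thesis
    by (simp add: jacobi_plane_def proj_plane_def subspace_Lambda_plane dim_Lambda_plane Lambda_subset_X card_Lambda_nodes)
qed

end

subsection \<open>Planes contained in the quartic\<close>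

lemma Pi_planes_indices:
  "Pi_planes \<eta> = {Pi_plane \<eta> i j | i j. i \<in> indices \<and> j \<in> indices \<and> i \<noteq> j}"
  unfolding Pi_planes_def indices_def ..

text \<open>The complement of {p, q} has three elements, so \<open>r\<close>, \<open>s\<close>,
  \<open>t\<close> are forced to be distinct and the set condition amounts to
  \<open>frame\<close>.\<close>

lemma Lambda_planes_indices:
  "Lambda_planes \<eta> \<zeta> = {Lambda_plane \<eta> \<zeta> p q r s t | p q r s t. p < q \<and> frame p q r s t}"
proof -
  have "p \<in> indices \<and> q \<in> indices \<and> p < q \<and> {r, s, t} = indices - {p, q} \<longleftrightarrow> p < q \<and> frame p q r s t" for p q r s t
  proof
    assume "p \<in> indices \<and> q \<in> indices \<and> p < q \<and> {r, s, t} = indices - {p, q}"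
    then have pq: "p \<in> indices" "q \<in> indices" "p < q" and rst: "{r, s, t} = indices - {p, q}"
      by blast+
    from pq have "card (indices - {p, q}) = 3"
      by (simp add: card_Diff_subset card_indices)
    then have "distinct [r, s, t]"
      unfolding rst[symmetric] using card_distinct[of "[r, s, t]"] by simp
    moreover have "{r, s, t} \<inter> {p, q} = {}" "{p, q} \<union> {r, s, t} = indices"
      unfolding rst using pq by blast+
    ultimately show "p < q \<and> frame p q r s t"
      unfolding frame_def using pq by auto
  next
    assume "p < q \<and> frame p q r s t"
    then have pq: "p < q" and f: "distinct [p, q, r, s, t]" "{p, q, r, s, t} = indices"
      unfolding frame_def by blast+
    show "p \<in> indices \<and> q \<in> indices \<and> p < q \<and> {r, s, t} = indices - {p, q}"
      unfolding f(2)[symmetric] using pq f(1) by auto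
  qed
  then show ?thesis unfolding Lambda_planes_def indices_def[symmetric] by (simp only:)
qed

lemma ex_frame:
  assumes "i \<in> indices" "j \<in> indices" "i \<noteq> j"
  shows "\<exists>r s t. frame i j r s t"
proof -
  have "card (indices - {i, j}) = 3"
    using assms by (simp add: card_Diff_subset card_indices)
  then obtain r s t where rst: "indices - {i, j} = {r, s, t}" "r \<noteq> s" "s \<noteq> t" "r \<noteq> t"
    unfolding card_3_iff by blast
  then have "frame i j r s t"
    unfolding frame_def using assms by auto
  then show ?thesis by blast
qed

lemma ex_frame_first:
  assumes "i \<in> indices"
  shows "\<exists>q r s t. frame i q r s t"
proof -
  have "card (indices - {i}) \<noteq> 0"
    using assms by (simp add: card_Diff_subset card_indices)
  then obtain j where "j \<in> indices - {i}" by (metis card.empty ex_in_conv)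
  then show ?thesis using ex_frame[of i j] assms by blast
qed

lemma no_six_indices:
  assumes "distinct xs" "length xs = 6" "set xs \<subseteq> indices"
  shows False
  using card_mono[OF _ assms(3)] distinct_card[OF assms(1)] assms(2) card_indices by simp

lemma ex_nonzero_index:
  fixes x :: "'a::zero ^ 6"
  assumes "x \<noteq> 0" "x $ 0 = 0"
  shows "\<exists>i\<in>indices. x $ i \<noteq> 0"
  using assms unfolding indices_eq_Compl vec_eq_iff by force

lemma lin_form_coords:
  "lin_form (\<lambda>x. x $ i + x $ j)" "lin_form (\<lambda>x. x $ i - x $ j)"
  "lin_form (\<lambda>x. x $ i + a * x $ j + b * x $ k)"
  by (simp_all add: lin_form_def algebra_simps)

context frame
begin

text \<open>With e_k taken in the other four coordinates the form is a^4 + a^2 (e_2 + u_p e_1) + e_4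
  + u_p e_3; at u_p = -a this is the expansion of the product.\<close>

lemma quartic_on_plus: "x $ 0 + x $ p = 0 \<Longrightarrow>
  quartic_form x = (x $ 0 - x $ q) * (x $ 0 - x $ r) * (x $ 0 - x $ s) * (x $ 0 - x $ t)"
  unfolding quartic_frame by algebra

lemma quartic_on_minus: "x $ 0 - x $ p = 0 \<Longrightarrow>
  quartic_form x = (x $ 0 + x $ q) * (x $ 0 + x $ r) * (x $ 0 + x $ s) * (x $ 0 + x $ t)"
  unfolding quartic_frame by algebra

text \<open>\<open>P\<close> is an arbitrary subspace, because the lemma serves both a plane and its
  section by a hyperplane in \<open>ex_proportional\<close>.\<close>

lemma linear_factor_plus:
  assumes "vec.subspace P" "\<And>x. x \<in> P \<Longrightarrow> quartic_form x = 0" "\<And>x. x \<in> P \<Longrightarrow> x $ 0 + x $ p = 0"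
  shows "\<exists>j\<in>indices - {p}. \<forall>x\<in>P. x $ 0 - x $ j = 0"
proof -
  have "\<forall>x\<in>P. prod_list (map (\<lambda>f. f x) [\<lambda>x. x $ 0 - x $ q, \<lambda>x. x $ 0 - x $ r, \<lambda>x. x $ 0 - x $ s, \<lambda>x. x $ 0 - x $ t]) = 0"
    using assms(2,3) quartic_on_plus by (simp add: mult.assoc)
  from lin_form_vanishes_if_prod_vanishes[OF assms(1) _ this]
  have "\<exists>f\<in>set [\<lambda>x. x $ 0 - x $ q, \<lambda>x. x $ 0 - x $ r, \<lambda>x. x $ 0 - x $ s, \<lambda>x. x $ 0 - x $ t]. \<forall>x\<in>P. f x = 0"
    by (simp add: lin_form_coords)
  then show ?thesis unfolding ix[symmetric] using dist by auto
qed

lemma linear_factor_minus: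
  assumes "vec.subspace P" "\<And>x. x \<in> P \<Longrightarrow> quartic_form x = 0" "\<And>x. x \<in> P \<Longrightarrow> x $ 0 - x $ p = 0"
  shows "\<exists>j\<in>indices - {p}. \<forall>x\<in>P. x $ 0 + x $ j = 0"
proof -
  have "\<forall>x\<in>P. prod_list (map (\<lambda>f. f x) [\<lambda>x. x $ 0 + x $ q, \<lambda>x. x $ 0 + x $ r, \<lambda>x. x $ 0 + x $ s, \<lambda>x. x $ 0 + x $ t]) = 0"
    using assms(2,3) quartic_on_minus by (simp add: mult.assoc)
  from lin_form_vanishes_if_prod_vanishes[OF assms(1) _ this]
  have "\<exists>f\<in>set [\<lambda>x. x $ 0 + x $ q, \<lambda>x. x $ 0 + x $ r, \<lambda>x. x $ 0 + x $ s, \<lambda>x. x $ 0 + x $ t]. \<forall>x\<in>P. f x = 0"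
    by (simp add: lin_form_coords)
  then show ?thesis unfolding ix[symmetric] using dist by auto
qed

end

section \<open>Classification of an arbitrary plane in the quartic\<close>

locale plane_in_X =
  fixes \<eta> \<zeta> :: complex and P :: "(complex ^ 6) set"
  assumes eta_sq: "\<eta>\<^sup>2 = -3" and zeta_def: "\<zeta> = (-1 + \<eta>) / 2"
    and plane: "proj_plane P" and sub: "P \<subseteq> X_quartic \<eta>"
begin

lemma subspace: "vec.subspace P" and dim: "vec.dim P = 3"
  using plane by (auto simp: proj_plane_def)

lemma quartic_0: "x \<in> P \<Longrightarrow> quartic_form x = 0" and in_L: "x \<in> P \<Longrightarrow> x \<in> L_hyp \<eta>"
  using sub by (auto simp: X_quartic_def)

lemma burkhardt: "frame p q r s t \<Longrightarrow> burkhardt p q r s t \<eta> \<zeta>"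
  by (simp add: burkhardt_def burkhardt_axioms_def eta_sq zeta_def)

lemma eq_Pi_plane:
  assumes "i \<in> indices" "j \<in> indices" "i \<noteq> j"
    and "\<And>x. x \<in> P \<Longrightarrow> x $ 0 + x $ i = 0" "\<And>x. x \<in> P \<Longrightarrow> x $ 0 - x $ j = 0"
  shows "P \<in> Pi_planes \<eta>"
proof -
  obtain r s t where f: "frame i j r s t" using ex_frame assms by blast
  have "P \<subseteq> Pi_plane \<eta> i j"
    using in_L assms unfolding Pi_plane_def by blast
  then have "P = Pi_plane \<eta> i j"
    using subspace frame.subspace_Pi_plane[OF f] dim burkhardt.dim_Pi_plane[OF burkhardt[OF f]]
    by (intro vec.subspace_dim_equal) simp_all
  then show ?thesis using assms unfolding Pi_planes_indices by blast
qed

lemma plus_vanishes: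
  assumes "i \<in> indices" "\<And>x. x \<in> P \<Longrightarrow> x $ 0 + x $ i = 0"
  shows "P \<in> Pi_planes \<eta>"
proof -
  obtain q r s t where f: "frame i q r s t" using ex_frame_first assms by blast
  from frame.linear_factor_plus[OF f subspace quartic_0 assms(2)]
  show ?thesis using eq_Pi_plane assms by blast
qed

lemma minus_vanishes:
  assumes "i \<in> indices" "\<And>x. x \<in> P \<Longrightarrow> x $ 0 - x $ i = 0"
  shows "P \<in> Pi_planes \<eta>"
proof -
  obtain q r s t where f: "frame i q r s t" using ex_frame_first assms by blast
  from frame.linear_factor_minus[OF f subspace quartic_0 assms(2)]
  show ?thesis using plus_vanishes by blast
qed

lemma eq_Lambda_plane:
  assumes f: "frame p q r s t" and "p < q" and "\<And>x. x \<in> P \<Longrightarrow> x $ p + x $ q = 0"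
    "\<And>x. x \<in> P \<Longrightarrow> x $ r + \<zeta> * x $ s + \<zeta>\<^sup>2 * x $ t = 0"
  shows "P \<in> Lambda_planes \<eta> \<zeta>"
proof -
  have "P \<subseteq> Lambda_plane \<eta> \<zeta> p q r s t"
    using in_L assms unfolding Lambda_plane_def by blast
  then have "P = Lambda_plane \<eta> \<zeta> p q r s t"
    using subspace frame.subspace_Lambda_plane[OF f] dim burkhardt.dim_Lambda_plane[OF burkhardt[OF f]]
    by (intro vec.subspace_dim_equal) simp_all
  then show ?thesis using assms(1,2) unfolding Lambda_planes_indices by blast
qed

lemma sum_vanishes_less:
  assumes "p \<in> indices" "q \<in> indices" "p < q" and sum: "\<And>x. x \<in> P \<Longrightarrow> x $ p + x $ q = 0"
  shows "P \<in> Pi_planes \<eta> \<union> Lambda_planes \<eta> \<zeta>"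
proof -
  obtain r s t where f: "frame p q r s t" using ex_frame assms by blast
  interpret burkhardt p q r s t \<eta> \<zeta> using burkhardt[OF f] .
  let ?fs = "[\<lambda>x. x $ 0 + x $ p, \<lambda>x. x $ 0 - x $ p, \<lambda>x. x $ r + \<zeta> * x $ s + \<zeta>\<^sup>2 * x $ t,
    \<lambda>x. x $ r + \<zeta> * x $ t + \<zeta>\<^sup>2 * x $ s] :: (complex ^ 6 \<Rightarrow> complex) list"
  have "\<forall>x\<in>P. prod_list (map (\<lambda>f. f x) ?fs) = 0"
  proof
    fix x assume x: "x \<in> P"
    \<comment> \<open>The left side is -3 times the quartic form: for \<open>u_p + u_q = 0\<close>
      the form is (a^2 - u_p^2)(a^2 + e_2), and the two \<zeta>-forms multiply to -3 (a^2 +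
      e_2).\<close>
    have "(x $ 0 + x $ p) * ((x $ 0 - x $ p) * ((x $ r + \<zeta> * x $ s + \<zeta>\<^sup>2 * x $ t) * (x $ r + \<zeta> * x $ t + \<zeta>\<^sup>2 * x $ s))) = 0"
      using in_L[OF x] quartic_0[OF x] sum[OF x] zeta_sq eta_sq unfolding L_hyp_frame quartic_frame by algebra
    then show "prod_list (map (\<lambda>f. f x) ?fs) = 0" by simp
  qed
  from lin_form_vanishes_if_prod_vanishes[OF subspace _ this]
  have "\<exists>f\<in>set ?fs. \<forall>x\<in>P. f x = 0"
    by (simp add: lin_form_coords)
  then consider "\<And>x. x \<in> P \<Longrightarrow> x $ 0 + x $ p = 0" | "\<And>x. x \<in> P \<Longrightarrow> x $ 0 - x $ p = 0"
    | "\<And>x. x \<in> P \<Longrightarrow> x $ r + \<zeta> * x $ s + \<zeta>\<^sup>2 * x $ t = 0"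
    | "\<And>x. x \<in> P \<Longrightarrow> x $ r + \<zeta> * x $ t + \<zeta>\<^sup>2 * x $ s = 0"
    by auto
  then show ?thesis
  proof cases
    case 1
    then show ?thesis using plus_vanishes assms by blast
  next
    case 2
    then show ?thesis using minus_vanishes assms by blast
  next
    case 3
    then show ?thesis using eq_Lambda_plane[OF f] assms by blast
  next
    case 4
    have "frame p q r t s" using f unfolding frame_def by (auto simp: insert_commute)
    with 4 show ?thesis using eq_Lambda_plane assms by blast
  qed
qed

lemma sum_vanishes:
  assumes "p \<in> indices" "q \<in> indices" "p \<noteq> q" and "\<And>x. x \<in> P \<Longrightarrow> x $ p + x $ q = 0"
  shows "P \<in> Pi_planes \<eta> \<union> Lambda_planes \<eta> \<zeta>"
  using sum_vanishes_less[of p q] sum_vanishes_less[of q p] assms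
  by (metis add.commute neqE)

text \<open>On the section of \<open>P\<close> by a + u_m = 0 some a - u_j vanishes, hence it is a
  multiple of a + u_m on all of \<open>P\<close>. The factor is nonzero, since otherwise a - u_j
  would vanish on \<open>P\<close> and make it a \<Pi>-plane.\<close>

lemma ex_proportional:
  assumes "P \<notin> Pi_planes \<eta>" and m: "m \<in> indices"
  shows "\<exists>j\<in>indices - {m}. \<exists>c. c \<noteq> 0 \<and> (\<forall>z\<in>P. z $ 0 - z $ j = c * (z $ 0 + z $ m))"
proof -
  obtain q r s t where f: "frame m q r s t" using ex_frame_first m by blast
  obtain x where x: "x \<in> P" "x $ 0 + x $ m \<noteq> 0" using plus_vanishes assms by blast
  let ?K = "{x \<in> P. x $ 0 + x $ m = 0}"
  have "vec.subspace ?K"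
    using subspace unfolding vec.subspace_def by (auto simp: algebra_simps) (metis add.assoc add.commute add_0 distrib_left mult_zero_right)+
  from frame.linear_factor_plus[OF f this] quartic_0
  obtain j where j: "j \<in> indices - {m}" "\<forall>x\<in>?K. x $ 0 - x $ j = 0" by blast
  have "\<exists>c. \<forall>z\<in>P. z $ 0 - z $ j = c * (z $ 0 + z $ m)"
    by (rule lin_form_multiple_if_kernel[OF subspace lin_form_coords(1,2) x]) (use j in blast)
  then obtain c where c: "\<forall>z\<in>P. z $ 0 - z $ j = c * (z $ 0 + z $ m)" by blast
  moreover have "c \<noteq> 0"
    using c minus_vanishes[of j] j assms by auto
  ultimately show ?thesis using j by blast
qed

lemma in_Pi_or_Lambda: "P \<in> Pi_planes \<eta> \<union> Lambda_planes \<eta> \<zeta>"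
proof (rule ccontr)
  assume neg: "P \<notin> Pi_planes \<eta> \<union> Lambda_planes \<eta> \<zeta>"
  then have "\<forall>m\<in>indices. \<exists>j. j \<in> indices - {m} \<and> (\<exists>c. c \<noteq> 0 \<and> (\<forall>z\<in>P. z $ 0 - z $ j = c * (z $ 0 + z $ m)))"
    using ex_proportional by blast
  then obtain f where f: "\<And>m. m \<in> indices \<Longrightarrow> f m \<in> indices \<and> f m \<noteq> m \<and> (\<exists>c. c \<noteq> 0 \<and> (\<forall>z\<in>P. z $ 0 - z $ f m = c * (z $ 0 + z $ m)))"
    by (metis Diff_iff insertCI)
  then obtain c where c: "\<And>m. m \<in> indices \<Longrightarrow> c m \<noteq> 0"
    "\<And>m z. m \<in> indices \<Longrightarrow> z \<in> P \<Longrightarrow> z $ 0 - z $ f m = c m * (z $ 0 + z $ m)"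
    by metis
  \<comment> \<open>At a = 0 the relation reads -u_{f m} = c u_m with nonzero c, so vanishing of a
    coordinate is constant along orbits of \<open>f\<close>.\<close>
  have zero: "z $ f m = 0 \<longleftrightarrow> z $ m = 0" if "z \<in> P" "z $ 0 = 0" "m \<in> indices" for z m
    using c[OF that(3)] that by (metis add_0 diff_0 mult_eq_0_iff neg_equal_0_iff_equal)
  obtain x i where x: "x \<in> P" "x $ 0 = 0" "i \<in> indices" "x $ i \<noteq> 0"
    using ex_nonzero_two_coordinates_zero[OF subspace dim, of 0 0] ex_nonzero_index by metis
  \<comment> \<open>\<open>y\<close> vanishes along the orbit of \<open>i\<close> but not along that
    of \<open>k\<close>, which separates the two orbits.\<close>
  obtain y k where y: "y \<in> P" "y $ 0 = 0" "y $ i = 0" "k \<in> indices" "y $ k \<noteq> 0"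
    using ex_nonzero_two_coordinates_zero[OF subspace dim, of 0 i] ex_nonzero_index by metis
  note fi = f[OF x(3)] and fk = f[OF y(4)]
  show False
  proof (cases "\<forall>z\<in>P. z $ 0 = 0")
    case True
    obtain w m where w: "w \<in> P" "w $ i = 0" "w $ k = 0" "m \<in> indices" "w $ m \<noteq> 0"
      using ex_nonzero_two_coordinates_zero[OF subspace dim, of i k] ex_nonzero_index True by metis
    have "y $ f i = 0" "y $ f k \<noteq> 0" "w $ f i = 0" "w $ f k = 0" "w $ f m \<noteq> 0"
      using zero True x y w by auto
    then have "distinct [i, f i, k, f k, m, f m]"
      using y(3,5) w(2,3,5) fi fk f[OF w(4)] by auto
    then show False
      using no_six_indices[of "[i, f i, k, f k, m, f m]"] f x y w by auto
  next
    case False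
    then obtain u where u: "u \<in> P" "u $ 0 \<noteq> 0" by blast
    \<comment> \<open>If \<open>f\<close> exchanged \<open>m\<close> and \<open>f m\<close>,
      evaluation at \<open>z\<close> would make the two multipliers mutually inverse, and evaluation
      at \<open>u\<close> would make \<open>c m\<close> equal to 1; then u_m + u_{f m} = 0 on
      \<open>P\<close>, the case settled by \<open>sum_vanishes\<close>.\<close>
    have ff: "f (f m) \<noteq> m" if z: "z \<in> P" "z $ 0 = 0" "m \<in> indices" "z $ m \<noteq> 0" for z m
    proof
      assume eq: "f (f m) = m"
      note fm = f[OF z(3)]
      have rel: "v $ 0 - v $ f m = c m * (v $ 0 + v $ m)" "v $ 0 - v $ m = c (f m) * (v $ 0 + v $ f m)"
        if "v \<in> P" for v
        using c(2)[OF z(3) that] c(2)[of "f m", OF _ that] fm eq by auto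
      have "z $ m * (c m * c (f m) - 1) = 0"
        using rel[OF z(1)] z(2) by algebra
      then have cc: "c m * c (f m) = 1" using z(4) by simp
      have "u $ 0 * (c m - 1) = 0"
        using rel[OF u(1)] cc by algebra
      then have "c m = 1" using u by simp
      then have "v $ m + v $ f m = 0" if "v \<in> P" for v
        using rel(1)[OF that] by algebra
      then show False using sum_vanishes[of m "f m"] fm z(3) neg by auto
    qed
    have "y $ f i = 0" "y $ f (f i) = 0" "y $ f k \<noteq> 0" "y $ f (f k) \<noteq> 0"
      using zero[OF y(1,2)] fi fk x(3) y(3-5) by auto
    moreover have "f (f i) \<noteq> f i" "f (f k) \<noteq> f k"
      using f fi fk by blast+
    ultimately have "distinct [i, f i, f (f i), k, f k, f (f k)]"
      using y(3,5) fi fk ff[OF x] ff[OF y(1,2,4,5)] by auto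
    then show False
      using no_six_indices[of "[i, f i, f (f i), k, f k, f (f k)]"] f x y by auto
  qed
qed

end

subsection \<open>Counting the planes\<close>

lemma card_distinct_pairs: "card {(i, j). i \<in> indices \<and> j \<in> indices \<and> i \<noteq> j} = 20"
proof -
  have "{(i, j). i \<in> indices \<and> j \<in> indices \<and> i \<noteq> j} = indices \<times> indices - (\<lambda>i. (i, i)) ` indices"
    by auto
  moreover have "card ((\<lambda>i. (i, i)) ` indices) = 5"
    by (simp add: card_image inj_on_def card_indices)
  moreover have "(\<lambda>i. (i, i)) ` indices \<subseteq> indices \<times> indices" by auto
  ultimately show ?thesis
    by (simp add: card_Diff_subset card_cartesian_product card_indices)
qed

lemma card_ordered_pairs: "card {(i, j). i \<in> indices \<and> j \<in> indices \<and> i < j} = 10"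
proof -
  let ?D = "{(i, j). i \<in> indices \<and> j \<in> indices \<and> i < j}"
  have "{(i, j). i \<in> indices \<and> j \<in> indices \<and> i \<noteq> j} = ?D \<union> prod.swap ` ?D"
    by (auto simp: image_iff neq_iff)
  moreover have "finite ?D" by (rule finite_subset[of _ "indices \<times> indices"]) auto
  moreover have "?D \<inter> prod.swap ` ?D = {}" by auto
  ultimately have "20 = card ?D + card (prod.swap ` ?D)"
    using card_distinct_pairs by (simp add: card_Un_disjoint)
  then show ?thesis by (simp add: card_image)
qed

context burkhardt
begin

lemma Pi_plane_inj:
  assumes "Pi_plane \<eta> p q = Pi_plane \<eta> i j" "i \<in> indices" "j \<in> indices"
  shows "p = i \<and> q = j"
proof -
  \<comment> \<open>At this point a = 1 and the remaining coordinates 0, 0, \<eta> differ from 1 and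
    -1, so \<open>p\<close> and \<open>q\<close> can be recovered from it.\<close>
  have "pt 1 (-1) 1 0 0 \<eta> \<in> Pi_plane \<eta> i j"
    unfolding assms(1)[symmetric] by (simp add: mem_Pi_plane)
  then have *: "1 + pt 1 (-1) 1 0 0 \<eta> $ i = 0" "1 - pt 1 (-1) 1 0 0 \<eta> $ j = 0"
    unfolding Pi_plane_def by simp_all
  have i: "i \<in> {p, q, r, s, t}" and j: "j \<in> {p, q, r, s, t}"
    unfolding ix using assms by simp_all
  have "1 + \<eta> \<noteq> 0" "1 - \<eta> \<noteq> 0" using eta_sq by (auto simp: add_eq_0_iff)
  then show ?thesis
    using i j * by auto
qed

text \<open>The node \<open>E_p\<close> separates the families: after rescaling, its a-coordinate is
  \<eta> and all others are 1 or -1, so no a + u_i vanishes there.\<close>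

lemma Lambda_ne_Pi:
  assumes "i \<in> indices"
  shows "Lambda_plane \<eta> \<zeta> p q r s t \<noteq> Pi_plane \<eta> i j"
proof
  assume "Lambda_plane \<eta> \<zeta> p q r s t = Pi_plane \<eta> i j"
  then have "pt \<eta> 1 (-1) (-1) (-1) (-1) \<in> Pi_plane \<eta> i j"
    using Lambda_nodes_subset by (auto simp: Lambda_nodes_def)
  then have *: "\<eta> + pt \<eta> 1 (-1) (-1) (-1) (-1) $ i = 0"
    unfolding Pi_plane_def by simp
  have "\<eta> + 1 \<noteq> 0" "\<eta> - 1 \<noteq> 0"
    using eta_ne by (simp_all add: eq_neg_iff_add_eq_0[symmetric])
  moreover have "i \<in> {p, q, r, s, t}"
    unfolding ix using assms by simp
  ultimately show False using * by auto
qed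

text \<open>As \<zeta>^3 = 1, a cyclic shift multiplies the \<zeta>-form by a power of
  \<zeta>.\<close>

lemma Lambda_plane_cyclic: "Lambda_plane \<eta> \<zeta> i j l m k = Lambda_plane \<eta> \<zeta> i j k l m"
proof -
  have "x $ l + \<zeta> * x $ m + \<zeta>\<^sup>2 * x $ k = 0 \<longleftrightarrow> x $ k + \<zeta> * x $ l + \<zeta>\<^sup>2 * x $ m = 0" for x :: "complex ^ 6"
  proof
    assume "x $ l + \<zeta> * x $ m + \<zeta>\<^sup>2 * x $ k = 0"
    then show "x $ k + \<zeta> * x $ l + \<zeta>\<^sup>2 * x $ m = 0" using zeta_sq by algebra
  next
    assume "x $ k + \<zeta> * x $ l + \<zeta>\<^sup>2 * x $ m = 0"
    then show "x $ l + \<zeta> * x $ m + \<zeta>\<^sup>2 * x $ k = 0" using zeta_sq by algebra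
  qed
  then show ?thesis unfolding Lambda_plane_def by simp
qed

lemma Lambda_plane_reverse_ne: "Lambda_plane \<eta> \<zeta> p q r s t \<noteq> Lambda_plane \<eta> \<zeta> p q r t s"
proof
  assume eq: "Lambda_plane \<eta> \<zeta> p q r s t = Lambda_plane \<eta> \<zeta> p q r t s"
  have "1 + \<zeta> + \<zeta>\<^sup>2 = 0" "1 + \<zeta> * \<zeta> + \<zeta>\<^sup>2 * \<zeta>\<^sup>2 = 0"
    using zeta_sq by algebra+
  \<comment> \<open>The witness gives 1 + \<zeta>^2 + \<zeta>^4 = 0 in the first \<zeta>-form and 1
    + 1 + 1 in the reversed one.\<close>
  then have "pt 0 0 0 1 \<zeta> (\<zeta>\<^sup>2) \<in> Lambda_plane \<eta> \<zeta> p q r s t"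
    by (simp add: mem_Lambda_plane)
  then have "1 + \<zeta> * \<zeta>\<^sup>2 + \<zeta>\<^sup>2 * \<zeta> = 0"
    unfolding eq unfolding Lambda_plane_def by simp
  moreover have "\<zeta> * \<zeta>\<^sup>2 = 1" using zeta_sq by algebra
  ultimately show False by (simp add: mult.commute)
qed

lemma frame_same_pair:
  assumes "frame p q r' s' t'"
  shows "Lambda_plane \<eta> \<zeta> p q r' s' t' \<in> {Lambda_plane \<eta> \<zeta> p q r s t, Lambda_plane \<eta> \<zeta> p q r t s}"
proof -
  have f: "distinct [p, q, r', s', t']" "{p, q, r', s', t'} = {p, q, r, s, t}"
    using assms unfolding frame_def ix by blast+
  then have "r' \<in> {r, s, t}" "s' \<in> {r, s, t}" "t' \<in> {r, s, t}" "r' \<noteq> s'" "s' \<noteq> t'" "r' \<noteq> t'"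
    by auto
  then consider "r' = r \<and> s' = s \<and> t' = t" | "r' = s \<and> s' = t \<and> t' = r" | "r' = t \<and> s' = r \<and> t' = s"
    | "r' = r \<and> s' = t \<and> t' = s" | "r' = t \<and> s' = s \<and> t' = r" | "r' = s \<and> s' = r \<and> t' = t"
    by auto
  then show ?thesis
    using Lambda_plane_cyclic[of p q s t r] Lambda_plane_cyclic[of p q t r s]
      Lambda_plane_cyclic[of p q t s r] Lambda_plane_cyclic[of p q s r t]
    by cases simp_all
qed

text \<open>Recovers the index pair of a \<Lambda>-plane from its node T_C. If \<open>p'\<close>,
  \<open>q'\<close> were outside {p, q}, the entries 1 and -1 would sit among \<open>r'\<close>,
  \<open>s'\<close>, \<open>t'\<close>, and the \<zeta>-form would be a nonzero difference of two
  powers of \<zeta>.\<close>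

lemma T_mem_Lambda:
  assumes f: "frame p' q' r' s' t'" and mem: "pt 0 1 (-1) 0 0 0 \<in> Lambda_plane \<eta> \<zeta> p' q' r' s' t'"
  shows "{p', q'} = {p, q}"
proof -
  let ?T = "pt 0 1 (-1) 0 0 0"
  have idx: "{p', q', r', s', t'} = {p, q, r, s, t}" "distinct [p', q', r', s', t']"
    using f unfolding frame_def ix by blast+
  have T: "?T $ k = (if k = p then 1 else if k = q then -1 else 0)" if "k \<in> {p, q, r, s, t}" for k
    using that ne by auto
  have T': "?T $ p' = (if p' = p then 1 else if p' = q then -1 else 0)"
    "?T $ q' = (if q' = p then 1 else if q' = q then -1 else 0)"
    "?T $ r' = (if r' = p then 1 else if r' = q then -1 else 0)"
    "?T $ s' = (if s' = p then 1 else if s' = q then -1 else 0)"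
    "?T $ t' = (if t' = p then 1 else if t' = q then -1 else 0)"
    by (rule T, simp add: idx(1)[symmetric])+
  have sum: "?T $ p' + ?T $ q' = 0" "?T $ r' + \<zeta> * ?T $ s' + \<zeta>\<^sup>2 * ?T $ t' = 0"
    using mem unfolding Lambda_plane_def by simp_all
  have zeta: "\<zeta> \<noteq> 1" "\<zeta>\<^sup>2 \<noteq> 1" "\<zeta>\<^sup>2 \<noteq> \<zeta>"
  proof -
    show 1: "\<zeta> \<noteq> 1" using zeta_sq by auto
    show "\<zeta>\<^sup>2 \<noteq> \<zeta>"
    proof
      assume "\<zeta>\<^sup>2 = \<zeta>"
      then have "\<zeta> = 0 \<or> \<zeta> = 1" by (simp add: power2_eq_square)
      then show False using zeta_sq by auto
    qed
    show "\<zeta>\<^sup>2 \<noteq> 1"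
    proof
      assume "\<zeta>\<^sup>2 = 1"
      then have "\<zeta> = 1 \<or> \<zeta> = - 1" by (simp add: power2_eq_1_iff)
      then show False using zeta_sq by auto
    qed
  qed
  have idx': "r' \<noteq> s'" "r' \<noteq> t'" "s' \<noteq> t'" "s' \<noteq> r'" "t' \<noteq> r'" "t' \<noteq> s'"
    using idx(2) by auto
  have "p' \<noteq> q'" "p \<noteq> q" using idx(2) ne(1) by simp_all
  with sum(1) have "p' = p \<and> q' = q \<or> p' = q \<and> q' = p \<or> p' \<notin> {p, q} \<and> q' \<notin> {p, q}"
    unfolding T' by (auto split: if_splits)
  moreover have False if pq': "p' \<notin> {p, q}" "q' \<notin> {p, q}"
  proof -
    have "p \<in> {p', q', r', s', t'}" "q \<in> {p', q', r', s', t'}"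
      unfolding idx(1) by simp_all
    with pq' have "p \<in> {r', s', t'}" "q \<in> {r', s', t'}" by blast+
    then consider "p = r'" "q = s'" | "p = r'" "q = t'" | "p = s'" "q = r'" | "p = s'" "q = t'"
      | "p = t'" "q = r'" | "p = t'" "q = s'"
      using \<open>p \<noteq> q\<close> by blast
    then show False
      using sum(2)[unfolded T'] zeta idx' by cases auto
  qed
  ultimately show ?thesis by blast
qed

end

section \<open>Cardinalities of the two families\<close>

lemma card_Pi_planes:
  assumes "\<eta>\<^sup>2 = -3" "\<zeta> = (-1 + \<eta>) / 2"
  shows "card (Pi_planes \<eta>) = 20"
proof -
  let ?D = "{(i, j). i \<in> indices \<and> j \<in> indices \<and> i \<noteq> j}"
  have "Pi_planes \<eta> = (\<lambda>(i, j). Pi_plane \<eta> i j) ` ?D"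
    unfolding Pi_planes_indices by auto
  moreover have "inj_on (\<lambda>(i, j). Pi_plane \<eta> i j) ?D"
  proof (rule inj_onI, clarify)
    fix p q i j
    assume *: "p \<in> indices" "q \<in> indices" "p \<noteq> q" "i \<in> indices" "j \<in> indices"
      "Pi_plane \<eta> p q = Pi_plane \<eta> i j"
    then obtain r s t where "frame p q r s t" using ex_frame by blast
    then have "burkhardt p q r s t \<eta> \<zeta>" using assms by (simp add: burkhardt_def burkhardt_axioms_def)
    from burkhardt.Pi_plane_inj[OF this] * show "p = i \<and> q = j" by blast
  qed
  ultimately show ?thesis using card_distinct_pairs by (simp add: card_image)
qed

text \<open>Each of the ten pairs \<open>p < q\<close> contributes one plane per cyclic order of the
  other three indices, that is two; different pairs give different planes by
  \<open>T_mem_Lambda\<close>.\<close>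

lemma card_Lambda_planes:
  assumes "\<eta>\<^sup>2 = -3" "\<zeta> = (-1 + \<eta>) / 2"
  shows "card (Lambda_planes \<eta> \<zeta>) = 20"
proof -
  note burkhardt = burkhardt.intro[OF _ burkhardt_axioms.intro[OF assms]]
  let ?D = "{(p, q). p \<in> indices \<and> q \<in> indices \<and> p < q}"
  define F where "F = (\<lambda>(p, q). {Lambda_plane \<eta> \<zeta> p q r s t | r s t. frame p q r s t})"
  have "Lambda_planes \<eta> \<zeta> = (\<Union>d\<in>?D. F d)"
  proof -
    have "p \<in> indices \<and> q \<in> indices" if "frame p q r s t" for p q r s t
      using that unfolding frame_def by blast
    then show ?thesis unfolding Lambda_planes_indices F_def by blast
  qed
  moreover have card_F: "card (F d) = 2" if "d \<in> ?D" for d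
  proof -
    obtain p q where d: "d = (p, q)" "p \<in> indices" "q \<in> indices" "p < q" using \<open>d \<in> ?D\<close> by blast
    then obtain r s t where f: "frame p q r s t" using ex_frame[of p q] by auto
    then have f': "frame p q r t s" unfolding frame_def by auto
    interpret burkhardt p q r s t \<eta> \<zeta> using burkhardt f by blast
    have "F d = {Lambda_plane \<eta> \<zeta> p q r s t, Lambda_plane \<eta> \<zeta> p q r t s}"
      unfolding F_def d using frame_same_pair f f' by blast
    then show ?thesis using Lambda_plane_reverse_ne by simp
  qed
  moreover have "F d \<inter> F d' = {}" if dd: "d \<in> ?D" "d' \<in> ?D" "d \<noteq> d'" for d d'
  proof (rule ccontr)
    assume "F d \<inter> F d' \<noteq> {}"
    then obtain \<Lambda> where \<Lambda>: "\<Lambda> \<in> F d" "\<Lambda> \<in> F d'" by blast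
    obtain p q p' q' where d: "d = (p, q)" "d' = (p', q')" by (cases d, cases d')
    obtain r s t where f: "frame p q r s t" "\<Lambda> = Lambda_plane \<eta> \<zeta> p q r s t"
      using \<Lambda>(1) unfolding F_def d prod.case by blast
    obtain r' s' t' where f': "frame p' q' r' s' t'" "\<Lambda> = Lambda_plane \<eta> \<zeta> p' q' r' s' t'"
      using \<Lambda>(2) unfolding F_def d prod.case by blast
    interpret burkhardt p q r s t \<eta> \<zeta> using burkhardt f by blast
    have "pt 0 1 (-1) 0 0 0 \<in> Lambda_plane \<eta> \<zeta> p' q' r' s' t'"
      unfolding f'(2)[symmetric] f(2) using Lambda_nodes_subset by (simp add: Lambda_nodes_def)
    then have "{p', q'} = {p, q}" using T_mem_Lambda[OF f'(1)] by blast
    moreover have "p < q" "p' < q'" using dd d by auto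
    ultimately have "p = p' \<and> q = q'" by (metis doubleton_eq_iff order_less_asym)
    then show False using dd d by blast
  qed
  moreover have "finite ?D" by (rule finite_subset[of _ "indices \<times> indices"]) auto
  moreover have "finite (F d)" if "d \<in> ?D" for d
    using card_F[OF that] by (simp add: card_ge_0_finite)
  ultimately have "card (Lambda_planes \<eta> \<zeta>) = (\<Sum>d\<in>?D. card (F d))"
    by (simp add: card_UN_disjoint)
  also have "\<dots> = 20" using card_F card_ordered_pairs by simp
  finally show ?thesis .
qed

theorem theorem6p3:
  fixes \<eta> \<zeta> :: complex
  assumes "\<eta>\<^sup>2 = -3" and "\<zeta> = (-1 + \<eta>) / 2"
  shows "{P. jacobi_plane \<eta> P} = Pi_planes \<eta> \<union> Lambda_planes \<eta> \<zeta> \<and>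
         card (Pi_planes \<eta> \<union> Lambda_planes \<eta> \<zeta>) = 40"
proof
  note burkhardt = burkhardt.intro[OF _ burkhardt_axioms.intro[OF assms]]
  show "{P. jacobi_plane \<eta> P} = Pi_planes \<eta> \<union> Lambda_planes \<eta> \<zeta>"
  proof (intro set_eqI iffI)
    fix P assume "P \<in> {P. jacobi_plane \<eta> P}"
    then have "plane_in_X \<eta> \<zeta> P"
      using assms by (simp add: plane_in_X_def jacobi_plane_def)
    then show "P \<in> Pi_planes \<eta> \<union> Lambda_planes \<eta> \<zeta>"
      by (rule plane_in_X.in_Pi_or_Lambda)
  next
    fix P assume "P \<in> Pi_planes \<eta> \<union> Lambda_planes \<eta> \<zeta>"
    then show "P \<in> {P. jacobi_plane \<eta> P}"
    proof
      assume "P \<in> Pi_planes \<eta>"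
      then obtain i j where ij: "P = Pi_plane \<eta> i j" "i \<in> indices" "j \<in> indices" "i \<noteq> j"
        unfolding Pi_planes_indices by blast
      then obtain r s t where "frame i j r s t" using ex_frame by blast
      from burkhardt.jacobi_plane_Pi[OF burkhardt[OF this]] ij show ?thesis by simp
    next
      assume "P \<in> Lambda_planes \<eta> \<zeta>"
      then obtain p q r s t where "P = Lambda_plane \<eta> \<zeta> p q r s t" "frame p q r s t"
        unfolding Lambda_planes_indices by blast
      with burkhardt.jacobi_plane_Lambda[OF burkhardt] show ?thesis by simp
    qed
  qed
  have "Pi_planes \<eta> \<inter> Lambda_planes \<eta> \<zeta> = {}"
    unfolding Pi_planes_indices Lambda_planes_indices
    using burkhardt.Lambda_ne_Pi[OF burkhardt] by blast
  moreover have "finite (Pi_planes \<eta>)" "finite (Lambda_planes \<eta> \<zeta>)"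
    using card_Pi_planes[OF assms] card_Lambda_planes[OF assms] by (simp_all add: card_ge_0_finite)
  ultimately show "card (Pi_planes \<eta> \<union> Lambda_planes \<eta> \<zeta>) = 40"
    using card_Pi_planes[OF assms] card_Lambda_planes[OF assms] by (simp add: card_Un_disjoint)
qed

end
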